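(* Let $\Sigma'$ be the first-order theory in the language $\{+,\cdot,0,1,<\}$ axiomatized by A1–A21 (described in the context). Then $\Sigma'$ proves the following sentence $\mathbf{GS}^s$: for every prime $p$ there exists an element $n$ such that (i) every $t$ with $1<t<n$, $t$ relatively prime to $n$, and $v$ relatively prime to $t$ for every prime $v\le p$, is prime (i.e. $n$ is $p$-good), and (ii) for every $m$ with $n<m$ there exists $q$ with $1<q<m$, $q$ relatively prime to $m$, $u$ relatively prime to $q$ for every prime $u\le p$, and $q$ not prime (i.e. no $m>n$ is $p$-good).
   Context: Language $\{+,\cdot,0,1,<\}$. Axioms A1–A15 (universal closures; together the theory $\mathrm{PA}^-$, whose models are the nonnegative parts of discretely ordered commutative rings): A1 $(x+y)+z=x+(y+z)$; A2 $x+y=y+x$; A3 $(xy)z=x(yz)$; A4 $xy=yx$; A5 $x(y+z)=xy+xz$; A6 $x+0=x\wedge x\cdot 0=0$; A7 $x\cdot1=x$; A8 $x<y\wedge y<z\to x<z$; A9 $\neg x<x$; A10 $x<y\vee x=y\vee y<x$; A11 $x<y\to x+z<y+z$; A12 $0<z\wedge x<y\to xz<yz$; A13 $x<y\to\exists z\,(x+z=y)$; A14 $0<1\wedge(x>0\to x\ge 1)$; A15 $x>0\vee x=0$. Notation: $\bar k$ denotes the numeral $1+\dots+1$ ($k$ ones); $x\le y$ means $x<y\vee x=y$; $x\mid y$ means $\exists z\,(xz=y)$; $m,n$ are relatively prime if every common divisor of $m$ and $n$ equals $1$; $x$ is prime means $1<x$ and for all $a,b,c$, if $xc=ab$ then $x\mid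 a$ or $x\mid b$. Primes $a<b$ are consecutive if $b\le u$ for every prime $u>a$. A16: every prime $p$ has a prime $q>p$ with $q\le u$ for every prime $u>p$. A17: every prime $p>\bar2$ has a prime $q<p$ with $u\le q$ for every prime $u<p$. A18: for every $n>\bar4$ there is a prime $p$ with $p^2<n$ such that $n\le q^2$ for every prime $q>p$. A19: for all primes $r<p<q$ with $r,p$ consecutive, $p,q$ consecutive and $\overline{17}<q$: $q^2<\bar2pr$. A20: every $n>1$ has a prime divisor. A21: for all consecutive primes $p<q$ there is $k$ with $kp<q^2$ and $(k+1)p>q^2$. *)

theory Defs
  imports Main
begin

section \<open>First-order logic with equality over the language of ordered rings\<close>

text \<open>Variables are de Bruijn indices. Falsity, implication and the universal quantifier are
  primitive; the remaining connectives are the usual classical abbreviations.\<close>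

datatype tm =
    Var nat
  | Zero
  | One
  | Add tm tm
  | Mul tm tm

datatype fm =
    Falsum
  | Equal tm tm
  | Less tm tm
  | Imp fm fm
  | Forall fm

abbreviation Neg :: "fm \<Rightarrow> fm" where
  "Neg A \<equiv> Imp A Falsum"

primrec subst_tm :: "(nat \<Rightarrow> tm) \<Rightarrow> tm \<Rightarrow> tm" where
  "subst_tm s (Var i) = s i"
| "subst_tm s Zero = Zero"
| "subst_tm s One = One"
| "subst_tm s (Add t u) = Add (subst_tm s t) (subst_tm s u)"
| "subst_tm s (Mul t u) = Mul (subst_tm s t) (subst_tm s u)"

text \<open>The simultaneous substitution \<open>s\<close>, moved below one quantifier.\<close>

definition under_quantifier :: "(nat \<Rightarrow> tm) \<Rightarrow> nat \<Rightarrow> tm" where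
  "under_quantifier s = case_nat (Var 0) (\<lambda>i. subst_tm (\<lambda>j. Var (Suc j)) (s i))"

primrec subst_fm :: "(nat \<Rightarrow> tm) \<Rightarrow> fm \<Rightarrow> fm" where
  "subst_fm s Falsum = Falsum"
| "subst_fm s (Equal t u) = Equal (subst_tm s t) (subst_tm s u)"
| "subst_fm s (Less t u) = Less (subst_tm s t) (subst_tm s u)"
| "subst_fm s (Imp A B) = Imp (subst_fm s A) (subst_fm s B)"
| "subst_fm s (Forall A) = Forall (subst_fm (under_quantifier s) A)"

definition lift_fm :: "fm \<Rightarrow> fm" where
  "lift_fm = subst_fm (\<lambda>i. Var (Suc i))"

text \<open>Replace the variable bound by an outermost quantifier (index 0) by \<open>t\<close> and lower the
  remaining free variables.\<close>

definition instantiate :: "fm \<Rightarrow> tm \<Rightarrow> fm" where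
  "instantiate A t = subst_fm (case_nat t Var) A"

text \<open>Classical natural deduction. In \<open>Forall_I\<close>, lifting the hypotheses makes index 0 fresh for
  them; this is the eigenvariable condition.\<close>

inductive proves :: "fm set \<Rightarrow> fm \<Rightarrow> bool"  (infix "\<turnstile>" 45) where
  Assumption: "A \<in> T \<Longrightarrow> T \<turnstile> A"
| Imp_I: "insert A T \<turnstile> B \<Longrightarrow> T \<turnstile> Imp A B"
| Imp_E: "T \<turnstile> Imp A B \<Longrightarrow> T \<turnstile> A \<Longrightarrow> T \<turnstile> B"
| Contradiction: "insert (Neg A) T \<turnstile> Falsum \<Longrightarrow> T \<turnstile> A"
| Forall_I: "lift_fm ` T \<turnstile> A \<Longrightarrow> T \<turnstile> Forall A"
| Forall_E: "T \<turnstile> Forall A \<Longrightarrow> T \<turnstile> instantiate A t"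
| Equal_refl: "T \<turnstile> Equal t t"
| Equal_subst: "T \<turnstile> Equal t u \<Longrightarrow> T \<turnstile> instantiate A t \<Longrightarrow> T \<turnstile> instantiate A u"

section \<open>Named notation for formulas\<close>

text \<open>To write formulas with named bound variables, a term or formula is presented as a function
  of the number \<open>d\<close> of quantifiers it stands under. The variable bound by the quantifier at depth
  \<open>d\<close> is the index \<open>d' - Suc d\<close> when it occurs at depth \<open>d'\<close>. So a defined predicate applied to
  terms needs no lifting of its arguments, and capture cannot occur. A sentence is read off at
  depth 0.\<close>

type_synonym dtm = "nat \<Rightarrow> tm"
type_synonym dfm = "nat \<Rightarrow> fm"

definition all_d :: "(dtm \<Rightarrow> dfm) \<Rightarrow> dfm"  (binder "\<^bold>\<forall>" 10) where
  "all_d F = (\<lambda>d. Forall (F (\<lambda>d'. Var (d' - Suc d)) (Suc d)))"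

definition zero_d :: dtm  ("\<^bold>0") where "\<^bold>0 = (\<lambda>d. Zero)"
definition one_d :: dtm  ("\<^bold>1") where "\<^bold>1 = (\<lambda>d. One)"

definition add_d :: "dtm \<Rightarrow> dtm \<Rightarrow> dtm"  (infixl "\<^bold>+" 65) where
  "x \<^bold>+ y = (\<lambda>d. Add (x d) (y d))"

definition mul_d :: "dtm \<Rightarrow> dtm \<Rightarrow> dtm"  (infixl "\<^bold>*" 70) where
  "x \<^bold>* y = (\<lambda>d. Mul (x d) (y d))"

definition equal_d :: "dtm \<Rightarrow> dtm \<Rightarrow> dfm"  (infix "\<^bold>=" 50) where
  "x \<^bold>= y = (\<lambda>d. Equal (x d) (y d))"

definition less_d :: "dtm \<Rightarrow> dtm \<Rightarrow> dfm"  (infix "\<^bold><" 50) where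
  "x \<^bold>< y = (\<lambda>d. Less (x d) (y d))"

definition imp_d :: "dfm \<Rightarrow> dfm \<Rightarrow> dfm"  (infixr "\<^bold>\<longrightarrow>" 25) where
  "(A \<^bold>\<longrightarrow> B) = (\<lambda>d. Imp (A d) (B d))"

definition neg_d :: "dfm \<Rightarrow> dfm"  ("\<^bold>\<not> _" [40] 40) where
  "(\<^bold>\<not> A) = (\<lambda>d. Neg (A d))"

definition disj_d :: "dfm \<Rightarrow> dfm \<Rightarrow> dfm"  (infixr "\<^bold>\<or>" 30) where
  "(A \<^bold>\<or> B) = (\<^bold>\<not> A \<^bold>\<longrightarrow> B)"

definition conj_d :: "dfm \<Rightarrow> dfm \<Rightarrow> dfm"  (infixr "\<^bold>\<and>" 35) where
  "(A \<^bold>\<and> B) = (\<^bold>\<not> (A \<^bold>\<longrightarrow> \<^bold>\<not> B))"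

definition ex_d :: "(dtm \<Rightarrow> dfm) \<Rightarrow> dfm"  (binder "\<^bold>\<exists>" 10) where
  "(\<^bold>\<exists>x. F x) = (\<^bold>\<not> (\<^bold>\<forall>x. \<^bold>\<not> F x))"

section \<open>Arithmetical notions\<close>

fun num :: "nat \<Rightarrow> dtm" where
  "num 0 = \<^bold>0"
| "num (Suc 0) = \<^bold>1"
| "num (Suc (Suc k)) = num (Suc k) \<^bold>+ \<^bold>1"

definition leq :: "dtm \<Rightarrow> dtm \<Rightarrow> dfm"  (infix "\<^bold>\<le>" 50) where
  "x \<^bold>\<le> y = (x \<^bold>< y \<^bold>\<or> x \<^bold>= y)"

definition divides :: "dtm \<Rightarrow> dtm \<Rightarrow> dfm"  (infix "\<^bold>\<bar>" 50) where
  "x \<^bold>\<bar> y = (\<^bold>\<exists>z. x \<^bold>* z \<^bold>= y)"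

definition relprime :: "dtm \<Rightarrow> dtm \<Rightarrow> dfm" where
  "relprime m n = (\<^bold>\<forall>d. d \<^bold>\<bar> m \<^bold>\<and> d \<^bold>\<bar> n \<^bold>\<longrightarrow> d \<^bold>= \<^bold>1)"

definition prime :: "dtm \<Rightarrow> dfm" where
  "prime x = (\<^bold>1 \<^bold>< x \<^bold>\<and>
    (\<^bold>\<forall>a b c. x \<^bold>* c \<^bold>= a \<^bold>* b \<^bold>\<longrightarrow> x \<^bold>\<bar> a \<^bold>\<or> x \<^bold>\<bar> b))"

definition consecutive :: "dtm \<Rightarrow> dtm \<Rightarrow> dfm" where
  "consecutive a b = (prime a \<^bold>\<and> prime b \<^bold>\<and> a \<^bold>< b \<^bold>\<and>
    (\<^bold>\<forall>u. prime u \<^bold>\<and> a \<^bold>< u \<^bold>\<longrightarrow> b \<^bold>\<le> u))"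

definition good :: "dtm \<Rightarrow> dtm \<Rightarrow> dfm" where
  "good p n = (\<^bold>\<forall>t. \<^bold>1 \<^bold>< t \<^bold>\<and> t \<^bold>< n \<^bold>\<and> relprime t n \<^bold>\<and>
    (\<^bold>\<forall>v. prime v \<^bold>\<and> v \<^bold>\<le> p \<^bold>\<longrightarrow> relprime v t) \<^bold>\<longrightarrow> prime t)"

section \<open>The theory and the sentence\<close>

definition A1 :: dfm where "A1 = (\<^bold>\<forall>x y z. (x \<^bold>+ y) \<^bold>+ z \<^bold>= x \<^bold>+ (y \<^bold>+ z))"
definition A2 :: dfm where "A2 = (\<^bold>\<forall>x y. x \<^bold>+ y \<^bold>= y \<^bold>+ x)"
definition A3 :: dfm where "A3 = (\<^bold>\<forall>x y z. (x \<^bold>* y) \<^bold>* z \<^bold>= x \<^bold>* (y \<^bold>* z))"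
definition A4 :: dfm where "A4 = (\<^bold>\<forall>x y. x \<^bold>* y \<^bold>= y \<^bold>* x)"
definition A5 :: dfm where "A5 = (\<^bold>\<forall>x y z. x \<^bold>* (y \<^bold>+ z) \<^bold>= x \<^bold>* y \<^bold>+ x \<^bold>* z)"
definition A6 :: dfm where "A6 = (\<^bold>\<forall>x. x \<^bold>+ \<^bold>0 \<^bold>= x \<^bold>\<and> x \<^bold>* \<^bold>0 \<^bold>= \<^bold>0)"
definition A7 :: dfm where "A7 = (\<^bold>\<forall>x. x \<^bold>* \<^bold>1 \<^bold>= x)"
definition A8 :: dfm where "A8 = (\<^bold>\<forall>x y z. x \<^bold>< y \<^bold>\<and> y \<^bold>< z \<^bold>\<longrightarrow> x \<^bold>< z)"
definition A9 :: dfm where "A9 = (\<^bold>\<forall>x. \<^bold>\<not> x \<^bold>< x)"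
definition A10 :: dfm where "A10 = (\<^bold>\<forall>x y. x \<^bold>< y \<^bold>\<or> x \<^bold>= y \<^bold>\<or> y \<^bold>< x)"
definition A11 :: dfm where "A11 = (\<^bold>\<forall>x y z. x \<^bold>< y \<^bold>\<longrightarrow> x \<^bold>+ z \<^bold>< y \<^bold>+ z)"
definition A12 :: dfm where
  "A12 = (\<^bold>\<forall>x y z. \<^bold>0 \<^bold>< z \<^bold>\<and> x \<^bold>< y \<^bold>\<longrightarrow> x \<^bold>* z \<^bold>< y \<^bold>* z)"
definition A13 :: dfm where "A13 = (\<^bold>\<forall>x y. x \<^bold>< y \<^bold>\<longrightarrow> (\<^bold>\<exists>z. x \<^bold>+ z \<^bold>= y))"
definition A14 :: dfm where
  "A14 = (\<^bold>\<forall>x. \<^bold>0 \<^bold>< \<^bold>1 \<^bold>\<and> (\<^bold>0 \<^bold>< x \<^bold>\<longrightarrow> \<^bold>1 \<^bold>\<le> x))"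
definition A15 :: dfm where "A15 = (\<^bold>\<forall>x. \<^bold>0 \<^bold>< x \<^bold>\<or> x \<^bold>= \<^bold>0)"

definition A16 :: dfm where
  "A16 = (\<^bold>\<forall>p. prime p \<^bold>\<longrightarrow>
    (\<^bold>\<exists>q. prime q \<^bold>\<and> p \<^bold>< q \<^bold>\<and> (\<^bold>\<forall>u. prime u \<^bold>\<and> p \<^bold>< u \<^bold>\<longrightarrow> q \<^bold>\<le> u)))"

definition A17 :: dfm where
  "A17 = (\<^bold>\<forall>p. prime p \<^bold>\<and> num 2 \<^bold>< p \<^bold>\<longrightarrow>
    (\<^bold>\<exists>q. prime q \<^bold>\<and> q \<^bold>< p \<^bold>\<and> (\<^bold>\<forall>u. prime u \<^bold>\<and> u \<^bold>< p \<^bold>\<longrightarrow> u \<^bold>\<le> q)))"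

definition A18 :: dfm where
  "A18 = (\<^bold>\<forall>n. num 4 \<^bold>< n \<^bold>\<longrightarrow>
    (\<^bold>\<exists>p. prime p \<^bold>\<and> p \<^bold>* p \<^bold>< n \<^bold>\<and> (\<^bold>\<forall>q. prime q \<^bold>\<and> p \<^bold>< q \<^bold>\<longrightarrow> n \<^bold>\<le> q \<^bold>* q)))"

definition A19 :: dfm where
  "A19 = (\<^bold>\<forall>r p q. prime r \<^bold>\<and> prime p \<^bold>\<and> prime q \<^bold>\<and> r \<^bold>< p \<^bold>\<and> p \<^bold>< q \<^bold>\<and>
    consecutive r p \<^bold>\<and> consecutive p q \<^bold>\<and> num 17 \<^bold>< q \<^bold>\<longrightarrow> q \<^bold>* q \<^bold>< num 2 \<^bold>* p \<^bold>* r)"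

definition A20 :: dfm where
  "A20 = (\<^bold>\<forall>n. \<^bold>1 \<^bold>< n \<^bold>\<longrightarrow> (\<^bold>\<exists>p. prime p \<^bold>\<and> p \<^bold>\<bar> n))"

definition A21 :: dfm where
  "A21 = (\<^bold>\<forall>p q. consecutive p q \<^bold>\<longrightarrow>
    (\<^bold>\<exists>k. k \<^bold>* p \<^bold>< q \<^bold>* q \<^bold>\<and> q \<^bold>* q \<^bold>< (k \<^bold>+ \<^bold>1) \<^bold>* p))"

definition Sigma' :: "fm set" where
  "Sigma' = (\<lambda>A. A 0) ` {A1, A2, A3, A4, A5, A6, A7, A8, A9, A10, A11, A12, A13, A14, A15,
     A16, A17, A18, A19, A20, A21}"

definition GSs :: fm where
  "GSs = (\<^bold>\<forall>p. prime p \<^bold>\<longrightarrow>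
    (\<^bold>\<exists>n. good p n \<^bold>\<and>
      (\<^bold>\<forall>m. n \<^bold>< m \<^bold>\<longrightarrow>
        (\<^bold>\<exists>q. \<^bold>1 \<^bold>< q \<^bold>\<and> q \<^bold>< m \<^bold>\<and> relprime q m \<^bold>\<and>
          (\<^bold>\<forall>u. prime u \<^bold>\<and> u \<^bold>\<le> p \<^bold>\<longrightarrow> relprime u q) \<^bold>\<and> \<^bold>\<not> prime q)))) 0"

end

theory Submission
  imports Defs "HOL-Library.Countable" "HOL-Library.Infinite_Set" "HOL-Computational_Algebra.Primes"
begin

text \<open>By completeness it suffices to argue in a model. Let \<open>q\<close> and \<open>r\<close> be the next two primes
  after \<open>p\<close>. If \<open>m\<close> is \<open>p\<close>-good, then every prime \<open>s > p\<close> with \<open>s\<^sup>2 < m\<close> divides \<open>m\<close>,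
  since otherwise \<open>s\<^sup>2\<close> is a composite witness. For \<open>m > r\<^sup>2\<close> take consecutive primes
  \<open>s < P < Q\<close> with \<open>P\<^sup>2 < m \<le> Q\<^sup>2\<close>; then \<open>s P\<close> divides \<open>m\<close>, and \<open>m \<le> Q\<^sup>2 < 2 P s\<close> by A19 forces
  \<open>m = s P < P\<^sup>2\<close>, a contradiction. Below \<open>r\<^sup>2\<close> the largest good element is the largest multiple of \<open>q\<close>,
  which A21 provides. A19 needs \<open>Q > 17\<close>, so \<open>p < 11\<close> is treated separately: the largest good
  elements for \<open>p = 2, 3, 5, 7\<close> are \<open>105, 105, 154, 286\<close>.\<close>

text \<open>The Henkin chain runs through an enumeration of all formulas, and the elements of the
  term model are coded terms.\<close>

instance tm :: countable by countable_datatype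
instance fm :: countable by countable_datatype

section \<open>Substitution\<close>

lemma subst_tm_comp: "subst_tm s (subst_tm r t) = subst_tm (\<lambda>i. subst_tm s (r i)) t"
  by (induction t) simp_all

lemma under_quantifier_0 [simp]: "under_quantifier s 0 = Var 0"
  and under_quantifier_Suc [simp]:
    "under_quantifier s (Suc i) = subst_tm (\<lambda>j. Var (Suc j)) (s i)"
  by (simp_all add: under_quantifier_def)

lemma under_quantifier_comp:
  "subst_tm (under_quantifier s) (under_quantifier r i) =
     under_quantifier (\<lambda>i. subst_tm s (r i)) i"
  by (cases i) (simp_all add: subst_tm_comp)

lemma subst_fm_comp: "subst_fm s (subst_fm r A) = subst_fm (\<lambda>i. subst_tm s (r i)) A"
  by (induction A arbitrary: s r) (simp_all add: subst_tm_comp under_quantifier_comp)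

lemma subst_tm_Var [simp]: "subst_tm Var t = t"
  by (induction t) simp_all

lemma under_quantifier_Var [simp]: "under_quantifier Var = Var"
proof
  show "under_quantifier Var i = Var i" for i by (cases i) simp_all
qed

lemma subst_fm_Var [simp]: "subst_fm Var A = A"
  by (induction A) simp_all

lemma subst_tm_case_nat_lift [simp]:
  "subst_tm (case_nat t s) (subst_tm (\<lambda>j. Var (Suc j)) u) = subst_tm s u"
  by (simp add: subst_tm_comp)

lemma subst_case_nat_under:
  "subst_tm (case_nat t Var) (under_quantifier s i) = case_nat t s i"
  by (cases i) simp_all

text \<open>Filling the bound index after substituting below the quantifier is one simultaneous
  substitution, extended by \<open>case_nat\<close> just as \<open>sat\<close> extends an
  environment.\<close>

lemma instantiate_under_quantifier:
  "instantiate (subst_fm (under_quantifier s) A) t = subst_fm (case_nat t s) A"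
  by (simp add: instantiate_def subst_fm_comp subst_case_nat_under)

lemma subst_fm_instantiate:
  "subst_fm s (instantiate A t) = instantiate (subst_fm (under_quantifier s) A) (subst_tm s t)"
proof -
  have "(\<lambda>i. subst_tm s (case_nat t Var i)) = case_nat (subst_tm s t) s"
    by (auto split: nat.split)
  then show ?thesis
    unfolding instantiate_under_quantifier by (simp add: instantiate_def subst_fm_comp)
qed

lemma subst_fm_lift_fm:
  "subst_fm (under_quantifier s) (lift_fm A) = lift_fm (subst_fm s A)"
  by (simp add: lift_fm_def subst_fm_comp)

section \<open>Free variables\<close>

primrec fv_tm :: "tm \<Rightarrow> nat set" where
  "fv_tm (Var i) = {i}"
| "fv_tm Zero = {}"
| "fv_tm One = {}"
| "fv_tm (Add t u) = fv_tm t \<union> fv_tm u"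
| "fv_tm (Mul t u) = fv_tm t \<union> fv_tm u"

primrec fv_fm :: "fm \<Rightarrow> nat set" where
  "fv_fm Falsum = {}"
| "fv_fm (Equal t u) = fv_tm t \<union> fv_tm u"
| "fv_fm (Less t u) = fv_tm t \<union> fv_tm u"
| "fv_fm (Imp A B) = fv_fm A \<union> fv_fm B"
| "fv_fm (Forall A) = {i. Suc i \<in> fv_fm A}"

lemma finite_fv_tm: "finite (fv_tm t)"
  by (induction t) simp_all

lemma finite_fv_fm: "finite (fv_fm A)"
proof (induction A)
  case (Forall A)
  then have "finite (Suc -` fv_fm A)" by (rule finite_vimageI) simp
  then show ?case by (simp add: vimage_def)
qed (simp_all add: finite_fv_tm)

lemma subst_tm_cong_fv: "(\<And>i. i \<in> fv_tm t \<Longrightarrow> s i = r i) \<Longrightarrow> subst_tm s t = subst_tm r t"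
  by (induction t) simp_all

lemma subst_fm_cong_fv: "(\<And>i. i \<in> fv_fm A \<Longrightarrow> s i = r i) \<Longrightarrow> subst_fm s A = subst_fm r A"
proof (induction A arbitrary: s r)
  case (Forall A)
  have "under_quantifier s i = under_quantifier r i" if "i \<in> fv_fm A" for i
    using Forall.prems that by (cases i) simp_all
  then have "subst_fm (under_quantifier s) A = subst_fm (under_quantifier r) A"
    by (rule Forall.IH)
  then show ?case by simp
next
  case (Equal t u)
  then show ?case using subst_tm_cong_fv[of t s r] subst_tm_cong_fv[of u s r] by simp
next
  case (Less t u)
  then show ?case using subst_tm_cong_fv[of t s r] subst_tm_cong_fv[of u s r] by simp
next
  case (Imp A B)
  have "subst_fm s A = subst_fm r A" by (rule Imp.IH(1)) (simp add: Imp.prems)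
  moreover have "subst_fm s B = subst_fm r B" by (rule Imp.IH(2)) (simp add: Imp.prems)
  ultimately show ?case by simp
qed simp

section \<open>Natural deduction\<close>

lemma weakening: "T \<turnstile> A \<Longrightarrow> T \<subseteq> S \<Longrightarrow> S \<turnstile> A"
proof (induction arbitrary: S rule: proves.induct)
  case (Imp_I A T B)
  then have "insert A S \<turnstile> B" by blast
  then show ?case by (rule proves.Imp_I)
next
  case (Contradiction A T)
  then have "insert (Neg A) S \<turnstile> Falsum" by blast
  then show ?case by (rule proves.Contradiction)
next
  case (Forall_I T A)
  then have "lift_fm ` S \<turnstile> A" by blast
  then show ?case by (rule proves.Forall_I)
qed (blast intro: proves.intros)+

text \<open>This reduces the consistency of the union of an increasing chain to that of its
  stages.\<close>

lemma proves_finite: "T \<turnstile> A \<Longrightarrow> \<exists>F. finite F \<and> F \<subseteq> T \<and> F \<turnstile> A"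
proof (induction rule: proves.induct)
  case (Assumption A T)
  then have "finite {A}" "{A} \<subseteq> T" "{A} \<turnstile> A" by (simp_all add: proves.Assumption)
  then show ?case by blast
next
  case (Imp_I A T B)
  then obtain F where F: "finite F" "F \<subseteq> insert A T" "F \<turnstile> B" by blast
  then have "insert A (F - {A}) \<turnstile> B" by (blast intro: weakening)
  then have "F - {A} \<turnstile> Imp A B" by (rule proves.Imp_I)
  moreover have "finite (F - {A})" "F - {A} \<subseteq> T" using F by auto
  ultimately show ?case by blast
next
  case (Imp_E T A B)
  then obtain F G where "finite F" "F \<subseteq> T" "F \<turnstile> Imp A B" "finite G" "G \<subseteq> T" "G \<turnstile> A" by blast
  then have "finite (F \<union> G)" "F \<union> G \<subseteq> T" "F \<union> G \<turnstile> B"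
    by (auto intro: proves.Imp_E weakening)
  then show ?case by blast
next
  case (Contradiction A T)
  then obtain F where F: "finite F" "F \<subseteq> insert (Neg A) T" "F \<turnstile> Falsum" by blast
  then have "insert (Neg A) (F - {Neg A}) \<turnstile> Falsum" by (blast intro: weakening)
  then have "F - {Neg A} \<turnstile> A" by (rule proves.Contradiction)
  moreover have "finite (F - {Neg A})" "F - {Neg A} \<subseteq> T" using F by auto
  ultimately show ?case by blast
next
  case (Forall_I T A)
  then obtain F where F: "finite F" "F \<subseteq> lift_fm ` T" "F \<turnstile> A" by blast
  then obtain G where "G \<subseteq> T" "finite G" "F = lift_fm ` G"
    by (meson finite_subset_image)
  with F show ?case by (blast intro: proves.Forall_I)
next
  case (Equal_subst T t u A)
  then obtain F G where "finite F" "F \<subseteq> T" "F \<turnstile> Equal t u" "finite G" "G \<subseteq> T"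
    "G \<turnstile> instantiate A t" by blast
  then have "finite (F \<union> G)" "F \<union> G \<subseteq> T" "F \<union> G \<turnstile> Equal t u" "F \<union> G \<turnstile> instantiate A t"
    by (auto intro: weakening)
  then show ?case by (blast intro: proves.Equal_subst)
qed (blast intro: proves.intros)+

text \<open>Both \<open>lift_fm\<close> and \<open>instantiate\<close> commute with substitution, so
  every rule is stable under it. The purpose is to rename a fresh variable in a derivation.\<close>

lemma proves_subst: "T \<turnstile> A \<Longrightarrow> subst_fm s ` T \<turnstile> subst_fm s A"
proof (induction arbitrary: s rule: proves.induct)
  case (Imp_I A T B)
  then have "insert (subst_fm s A) (subst_fm s ` T) \<turnstile> subst_fm s B" by simp
  then show ?case by (simp add: proves.Imp_I)
next
  case (Imp_E T A B)
  then have "subst_fm s ` T \<turnstile> Imp (subst_fm s A) (subst_fm s B)" "subst_fm s ` T \<turnstile> subst_fm s A"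
    by simp_all
  then show ?case by (rule proves.Imp_E)
next
  case (Contradiction A T)
  have "insert (Neg (subst_fm s A)) (subst_fm s ` T) \<turnstile> Falsum"
    using Contradiction.IH[of s] by simp
  then show ?case by (rule proves.Contradiction)
next
  case (Forall_I T A)
  have "lift_fm ` subst_fm s ` T = subst_fm (under_quantifier s) ` lift_fm ` T"
    by (simp add: image_image subst_fm_lift_fm)
  then have "lift_fm ` subst_fm s ` T \<turnstile> subst_fm (under_quantifier s) A"
    using Forall_I.IH by simp
  then show ?case by (simp add: proves.Forall_I)
next
  case (Forall_E T A t)
  then have "subst_fm s ` T \<turnstile> Forall (subst_fm (under_quantifier s) A)" by simp
  then show ?case unfolding subst_fm_instantiate by (rule proves.Forall_E)
next
  case (Equal_subst T t u A)
  then have "subst_fm s ` T \<turnstile> Equal (subst_tm s t) (subst_tm s u)" by simp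
  moreover have "subst_fm s ` T \<turnstile> instantiate (subst_fm (under_quantifier s) A) (subst_tm s t)"
    using Equal_subst.IH(2)[of s] by (simp add: subst_fm_instantiate)
  ultimately show ?case unfolding subst_fm_instantiate by (rule proves.Equal_subst)
qed (simp_all add: proves.Assumption proves.Equal_refl)

text \<open>Substituting index 0 for the fresh \<open>Var k\<close> and lifting all other variables turns the hypothesis
  into a premise of \<open>Forall_I\<close>.\<close>

lemma Forall_I_fresh:
  assumes "T \<turnstile> instantiate A (Var k)" and T: "k \<notin> \<Union>(fv_fm ` T)" and A: "k \<notin> fv_fm (Forall A)"
  shows "T \<turnstile> Forall A"
proof -
  define s where "s = (\<lambda>i. Var (if i = k then 0 else Suc i))"
  have "subst_fm s B = lift_fm B" if "B \<in> T" for B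
    unfolding lift_fm_def using T that by (intro subst_fm_cong_fv) (auto simp: s_def)
  then have T': "subst_fm s ` T = lift_fm ` T" by simp
  have "subst_fm s (instantiate A (Var k)) = subst_fm (case_nat (Var 0) s) A"
    by (simp add: subst_fm_instantiate instantiate_under_quantifier s_def)
  also have "\<dots> = subst_fm Var A"
    using A by (intro subst_fm_cong_fv) (auto simp: s_def split: nat.split)
  finally have "subst_fm s (instantiate A (Var k)) = A" by simp
  with proves_subst[OF assms(1), of s] T' have "lift_fm ` T \<turnstile> A" by simp
  then show ?thesis by (rule proves.Forall_I)
qed

section \<open>Derived rules for negation and equality\<close>

lemma proves_Falsum: "T \<turnstile> Falsum \<Longrightarrow> T \<turnstile> A"
  by (rule Contradiction) (blast intro: weakening)

lemma proves_Neg_Imp: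
  assumes "T \<turnstile> Neg (Imp A B)"
  shows "T \<turnstile> A" and "T \<turnstile> Neg B"
proof -
  have "insert (Neg A) T \<turnstile> Imp A B"
    by (rule Imp_I, rule proves_Falsum) (blast intro: Imp_E Assumption)
  then have "insert (Neg A) T \<turnstile> Falsum"
    using assms by (blast intro: Imp_E weakening)
  then show "T \<turnstile> A" by (rule Contradiction)
  have "insert B T \<turnstile> Imp A B" by (blast intro: Imp_I Assumption)
  then have "insert B T \<turnstile> Falsum"
    using assms by (blast intro: Imp_E weakening)
  then show "T \<turnstile> Neg B" by (rule Imp_I)
qed

text \<open>Leibniz's rule in a form where concrete templates \<open>A\<close> evaluate:
  \<open>Var 0\<close> marks the place to be replaced, and lifted terms stay fixed. The congruence
  rules are instances.\<close>

lemma Equal_subst_tm: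
  assumes "T \<turnstile> Equal t u" and "T \<turnstile> subst_fm (case_nat t Var) A"
  shows "T \<turnstile> subst_fm (case_nat u Var) A"
  using Equal_subst[OF assms(1), of A] assms(2) by (simp add: instantiate_def)

abbreviation lift_tm :: "tm \<Rightarrow> tm" where
  "lift_tm \<equiv> subst_tm (\<lambda>j. Var (Suc j))"

lemma proves_Equal_sym: "T \<turnstile> Equal t u \<Longrightarrow> T \<turnstile> Equal u t"
  using Equal_subst_tm[of T t u "Equal (Var 0) (lift_tm t)"] by (simp add: Equal_refl)

lemma proves_Equal_trans: "T \<turnstile> Equal t u \<Longrightarrow> T \<turnstile> Equal u v \<Longrightarrow> T \<turnstile> Equal t v"
  using Equal_subst_tm[of T u v "Equal (lift_tm t) (Var 0)"] by simp

lemma proves_Equal_Add: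
  assumes "T \<turnstile> Equal t t'" and "T \<turnstile> Equal u u'"
  shows "T \<turnstile> Equal (Add t u) (Add t' u')"
proof -
  have "T \<turnstile> Equal (Add t u) (Add t' u)"
    using Equal_subst_tm[OF assms(1), of "Equal (lift_tm (Add t u)) (Add (Var 0) (lift_tm u))"]
    by (simp add: Equal_refl)
  then show ?thesis
    using Equal_subst_tm[OF assms(2), of "Equal (lift_tm (Add t u)) (Add (lift_tm t') (Var 0))"]
    by simp
qed

lemma proves_Equal_Mul:
  assumes "T \<turnstile> Equal t t'" and "T \<turnstile> Equal u u'"
  shows "T \<turnstile> Equal (Mul t u) (Mul t' u')"
proof -
  have "T \<turnstile> Equal (Mul t u) (Mul t' u)"
    using Equal_subst_tm[OF assms(1), of "Equal (lift_tm (Mul t u)) (Mul (Var 0) (lift_tm u))"]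
    by (simp add: Equal_refl)
  then show ?thesis
    using Equal_subst_tm[OF assms(2), of "Equal (lift_tm (Mul t u)) (Mul (lift_tm t') (Var 0))"]
    by simp
qed

lemma proves_Less_cong:
  assumes "T \<turnstile> Equal t t'" and "T \<turnstile> Equal u u'" and "T \<turnstile> Less t u"
  shows "T \<turnstile> Less t' u'"
proof -
  have "T \<turnstile> Less t' u"
    using Equal_subst_tm[OF assms(1), of "Less (Var 0) (lift_tm u)"] assms(3) by simp
  then show ?thesis
    using Equal_subst_tm[OF assms(2), of "Less (lift_tm t') (Var 0)"] by simp
qed

section \<open>The Henkin construction\<close>

definition fresh_var :: "fm set \<Rightarrow> nat" where
  "fresh_var T = (SOME k. k \<notin> \<Union>(fv_fm ` T))"

text \<open>A rejected formula leaves the set unchanged, since its negation is then already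
  derivable by \<open>Imp_I\<close>.\<close>

definition decide :: "fm \<Rightarrow> fm set \<Rightarrow> fm set" where
  "decide A T = (if insert A T \<turnstile> Falsum then T else insert A T)"

text \<open>The fresh variable acts as a Henkin constant: if \<open>Forall A\<close> fails, the
  instance at that variable is a counterexample.\<close>

definition add_witness :: "fm \<Rightarrow> fm set \<Rightarrow> fm set" where
  "add_witness A T =
    insert (Imp (instantiate A (Var (fresh_var (insert (Forall A) T)))) (Forall A)) T"

primrec henkin_chain :: "fm set \<Rightarrow> nat \<Rightarrow> fm set" where
  "henkin_chain T 0 = T"
| "henkin_chain T (Suc n) = add_witness (from_nat n) (decide (from_nat n) (henkin_chain T n))"

definition henkin :: "fm set \<Rightarrow> bool" where
  "henkin H \<longleftrightarrow> \<not> H \<turnstile> Falsum \<and> (\<forall>A. A \<in> H \<or> insert A H \<turnstile> Falsum) \<and>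
    (\<forall>A. \<exists>k. Imp (instantiate A (Var k)) (Forall A) \<in> H)"

lemma finite_fv_fm_insert:
  "finite (\<Union>(fv_fm ` T)) \<Longrightarrow> finite (\<Union>(fv_fm ` insert A T))"
  by (simp add: finite_fv_fm)

lemma finite_fv_decide:
  "finite (\<Union>(fv_fm ` T)) \<Longrightarrow> finite (\<Union>(fv_fm ` decide A T))"
  unfolding decide_def by (metis finite_fv_fm_insert)

text \<open>Each stage adds at most two formulas, so a fresh variable is always left.\<close>

lemma finite_fv_henkin_chain:
  assumes "finite (\<Union>(fv_fm ` T))"
  shows "finite (\<Union>(fv_fm ` henkin_chain T n))"
proof (induction n)
  case (Suc n)
  then show ?case
    unfolding henkin_chain.simps add_witness_def by (intro finite_fv_fm_insert finite_fv_decide)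
qed (simp add: assms)

lemma fresh_var:
  assumes "finite (\<Union>(fv_fm ` T))"
  shows "fresh_var T \<notin> \<Union>(fv_fm ` T)"
  unfolding fresh_var_def using ex_new_if_finite[OF infinite_UNIV_nat assms] by (rule someI_ex)

text \<open>Refuting the witness formula would prove both the instance at the fresh variable and the
  negation of \<open>Forall A\<close>. Generalising the instance gives a contradiction.\<close>

lemma consistent_add_witness:
  assumes "\<not> T \<turnstile> Falsum" and "finite (\<Union>(fv_fm ` T))"
  shows "\<not> add_witness A T \<turnstile> Falsum"
proof
  define k where "k = fresh_var (insert (Forall A) T)"
  have k: "k \<notin> \<Union>(fv_fm ` insert (Forall A) T)"
    unfolding k_def using assms(2) by (intro fresh_var finite_fv_fm_insert)
  assume "add_witness A T \<turnstile> Falsum"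
  then have N: "T \<turnstile> Neg (Imp (instantiate A (Var k)) (Forall A))"
    unfolding add_witness_def k_def by (rule Imp_I)
  have "T \<turnstile> Forall A"
    using proves_Neg_Imp(1)[OF N] by (rule Forall_I_fresh) (use k in auto)
  with proves_Neg_Imp(2)[OF N] have "T \<turnstile> Falsum" by (rule Imp_E)
  with assms(1) show False ..
qed

lemma consistent_henkin_chain:
  assumes "\<not> T \<turnstile> Falsum" and fin: "finite (\<Union>(fv_fm ` T))"
  shows "\<not> henkin_chain T n \<turnstile> Falsum"
proof (induction n)
  case 0
  show ?case using assms(1) by simp
next
  case (Suc n)
  then have "\<not> decide (from_nat n) (henkin_chain T n) \<turnstile> Falsum" by (simp add: decide_def)
  then show ?case
    unfolding henkin_chain.simps using finite_fv_henkin_chain[OF fin]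
    by (intro consistent_add_witness finite_fv_decide)
qed

lemma henkin_chain_mono: "m \<le> n \<Longrightarrow> henkin_chain T m \<subseteq> henkin_chain T n"
  by (rule lift_Suc_mono_le[of "henkin_chain T"]) (auto simp: add_witness_def decide_def)

lemma finite_subset_henkin_chain:
  assumes "finite F" and "F \<subseteq> (\<Union>n. henkin_chain T n)"
  shows "\<exists>n. F \<subseteq> henkin_chain T n"
  using assms
proof (induction F)
  case (insert A F)
  then obtain m n where "F \<subseteq> henkin_chain T m" "A \<in> henkin_chain T n" by blast
  moreover have "henkin_chain T m \<subseteq> henkin_chain T (max m n)"
    "henkin_chain T n \<subseteq> henkin_chain T (max m n)" by (simp_all add: henkin_chain_mono)
  ultimately show ?case by blast
qed simp

lemma henkin_extension:
  assumes "\<not> T \<turnstile> Falsum" and "finite (\<Union>(fv_fm ` T))"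
  shows "\<exists>H. henkin H \<and> T \<subseteq> H"
proof -
  define H where "H = (\<Union>n. henkin_chain T n)"
  have "\<not> H \<turnstile> Falsum"
  proof
    assume "H \<turnstile> Falsum"
    then obtain F where "finite F" "F \<subseteq> H" "F \<turnstile> Falsum" using proves_finite by blast
    moreover from this obtain n where "F \<subseteq> henkin_chain T n"
      unfolding H_def by (metis finite_subset_henkin_chain)
    ultimately have "henkin_chain T n \<turnstile> Falsum" by (blast intro: weakening)
    with consistent_henkin_chain[OF assms] show False by blast
  qed
  \<comment> \<open>The formula \<open>A\<close> is decided at stage \<open>to_nat A\<close>, and an
    inconsistency found there persists in the union.\<close>
  moreover have "A \<in> H \<or> insert A H \<turnstile> Falsum" for A
  proof (cases "insert A (henkin_chain T (to_nat A)) \<turnstile> Falsum")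
    case True
    then show ?thesis unfolding H_def by (blast intro: weakening)
  next
    case False
    then have "A \<in> henkin_chain T (Suc (to_nat A))"
      by (simp add: add_witness_def decide_def)
    then show ?thesis unfolding H_def by blast
  qed
  moreover have "\<exists>k. Imp (instantiate A (Var k)) (Forall A) \<in> H" for A
  proof -
    have "\<exists>k. Imp (instantiate A (Var k)) (Forall A) \<in> henkin_chain T (Suc (to_nat A))"
      by (auto simp: add_witness_def)
    then show ?thesis unfolding H_def by blast
  qed
  moreover have "T \<subseteq> H" unfolding H_def using UN_upper[of 0 UNIV "henkin_chain T"] by simp
  ultimately show ?thesis unfolding henkin_def by blast
qed

text \<open>Maximality gives deductive closure: a derivable formula whose addition is inconsistent
  would make \<open>H\<close> itself inconsistent.\<close>

lemma henkin_mem_iff: "henkin H \<Longrightarrow> A \<in> H \<longleftrightarrow> H \<turnstile> A"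
  unfolding henkin_def by (meson Assumption Imp_E Imp_I)

lemma henkin_Falsum: "henkin H \<Longrightarrow> Falsum \<notin> H"
  unfolding henkin_def by (blast intro: Assumption)

lemma henkin_Imp:
  assumes "henkin H"
  shows "Imp A B \<in> H \<longleftrightarrow> (A \<in> H \<longrightarrow> B \<in> H)"
proof
  show "A \<in> H \<longrightarrow> B \<in> H" if "Imp A B \<in> H"
    using that Imp_E by (auto simp: henkin_mem_iff[OF assms])
next
  assume *: "A \<in> H \<longrightarrow> B \<in> H"
  show "Imp A B \<in> H"
  proof (cases "A \<in> H")
    case True
    with * have "B \<in> H" by simp
    then have "insert A H \<turnstile> B" by (blast intro: Assumption)
    then show ?thesis by (simp add: henkin_mem_iff[OF assms] Imp_I)
  next
    case False
    then have "insert A H \<turnstile> Falsum" using assms unfolding henkin_def by blast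
    then show ?thesis by (simp add: henkin_mem_iff[OF assms] Imp_I proves_Falsum)
  qed
qed

lemma henkin_Forall:
  assumes "henkin H"
  shows "Forall A \<in> H \<longleftrightarrow> (\<forall>t. instantiate A t \<in> H)"
proof
  show "\<forall>t. instantiate A t \<in> H" if "Forall A \<in> H"
    using that Forall_E by (auto simp: henkin_mem_iff[OF assms])
  \<comment> \<open>The single instance at the witness variable \<open>Var k\<close> already implies
    the universal formula.\<close>
  obtain k where "Imp (instantiate A (Var k)) (Forall A) \<in> H"
    using assms unfolding henkin_def by blast
  then show "Forall A \<in> H" if "\<forall>t. instantiate A t \<in> H"
    using that by (simp add: henkin_Imp[OF assms])
qed

section \<open>Models\<close>

text \<open>The carrier is kept apart from the type because the first term model on
  \<open>nat\<close> only fills the range of its naming map.\<close>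

record 'a model =
  carrier :: "'a set"
  zero_m :: 'a
  one_m :: 'a
  add_m :: "'a \<Rightarrow> 'a \<Rightarrow> 'a"
  mul_m :: "'a \<Rightarrow> 'a \<Rightarrow> 'a"
  less_m :: "'a \<Rightarrow> 'a \<Rightarrow> bool"

primrec tm_val :: "('a, 'b) model_scheme \<Rightarrow> (nat \<Rightarrow> 'a) \<Rightarrow> tm \<Rightarrow> 'a" where
  "tm_val M e (Var i) = e i"
| "tm_val M e Zero = zero_m M"
| "tm_val M e One = one_m M"
| "tm_val M e (Add t u) = add_m M (tm_val M e t) (tm_val M e u)"
| "tm_val M e (Mul t u) = mul_m M (tm_val M e t) (tm_val M e u)"

primrec sat :: "('a, 'b) model_scheme \<Rightarrow> (nat \<Rightarrow> 'a) \<Rightarrow> fm \<Rightarrow> bool" where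
  "sat M e Falsum \<longleftrightarrow> False"
| "sat M e (Equal t u) \<longleftrightarrow> tm_val M e t = tm_val M e u"
| "sat M e (Less t u) \<longleftrightarrow> less_m M (tm_val M e t) (tm_val M e u)"
| "sat M e (Imp A B) \<longleftrightarrow> (sat M e A \<longrightarrow> sat M e B)"
| "sat M e (Forall A) \<longleftrightarrow> (\<forall>x\<in>carrier M. sat M (case_nat x e) A)"

text \<open>The term model of \<open>H\<close>, with the elements named by an arbitrary map \<open>c\<close> that identifies
  exactly the terms that \<open>H\<close> makes equal.\<close>

definition term_model :: "fm set \<Rightarrow> (tm \<Rightarrow> 'a) \<Rightarrow> 'a model" where
  "term_model H c = \<lparr>carrier = range c, zero_m = c Zero, one_m = c One,
     add_m = (\<lambda>a b. c (Add (inv c a) (inv c b))),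
     mul_m = (\<lambda>a b. c (Mul (inv c a) (inv c b))),
     less_m = (\<lambda>a b. Less (inv c a) (inv c b) \<in> H)\<rparr>"

text \<open>The truth lemma. It is stated for all assignments named by a substitution
  \<open>s\<close>, so that the quantifier case can put any term at index 0; every element of the
  carrier is named by a term.\<close>

lemma term_model_sat_iff:
  assumes H: "henkin H" and c: "\<And>t u. c t = c u \<longleftrightarrow> Equal t u \<in> H"
  shows "sat (term_model H c) (\<lambda>i. c (s i)) A \<longleftrightarrow> subst_fm s A \<in> H"
proof -
  note mem = henkin_mem_iff[OF H]
  \<comment> \<open>The representative chosen by \<open>inv c\<close> is provably equal to the given
    term, which makes the operations independent of the choice.\<close>
  have inv: "H \<turnstile> Equal (inv c (c t)) t" for t
    using c[of "inv c (c t)" t] by (simp add: f_inv_into_f mem)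
  have tm_val: "tm_val (term_model H c) (\<lambda>i. c (s i)) t = c (subst_tm s t)" for s t
    by (induction t)
      (simp_all add: term_model_def c mem proves_Equal_Add proves_Equal_Mul inv)
  have less: "less_m (term_model H c) (c t) (c u) \<longleftrightarrow> Less t u \<in> H" for t u
    using proves_Less_cong[OF inv[of t] inv[of u]]
      proves_Less_cong[OF inv[THEN proves_Equal_sym, of t] inv[THEN proves_Equal_sym, of u]]
    by (auto simp: term_model_def mem)
  show ?thesis
  proof (induction A arbitrary: s)
    case (Forall A)
    have "(\<lambda>i. c (case_nat t s i)) = case_nat (c t) (\<lambda>i. c (s i))" for t
      by (auto split: nat.split)
    then have "sat (term_model H c) (case_nat (c t) (\<lambda>i. c (s i))) A \<longleftrightarrow>
        instantiate (subst_fm (under_quantifier s) A) t \<in> H" for t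
      using Forall[of "case_nat t s"] by (simp add: instantiate_under_quantifier)
    moreover have "carrier (term_model H c) = range c" by (simp add: term_model_def)
    ultimately show ?case by (simp add: henkin_Forall[OF H])
  qed (simp_all add: tm_val less c henkin_Falsum[OF H] henkin_Imp[OF H])
qed

text \<open>Provable equality is an equivalence relation; the name of a term is the code of a chosen
  representative of its class.\<close>

lemma term_naming_exists:
  assumes H: "henkin H"
  shows "\<exists>c :: tm \<Rightarrow> nat. \<forall>t u. c t = c u \<longleftrightarrow> Equal t u \<in> H"
proof -
  define r where "r = (\<lambda>t. SOME u. Equal t u \<in> H)"
  note mem = henkin_mem_iff[OF H]
  have r: "H \<turnstile> Equal t (r t)" for t
    unfolding r_def mem[symmetric] by (rule someI[of _ t]) (simp add: mem Equal_refl)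
  have "r t = r u \<longleftrightarrow> Equal t u \<in> H" for t u
  proof
    assume "r t = r u"
    then show "Equal t u \<in> H"
      unfolding mem using r[of t] r[of u] by (metis proves_Equal_sym proves_Equal_trans)
  next
    assume "Equal t u \<in> H"
    then have "Equal t v \<in> H \<longleftrightarrow> Equal u v \<in> H" for v
      unfolding mem by (metis proves_Equal_sym proves_Equal_trans)
    then show "r t = r u" unfolding r_def by simp
  qed
  then have "\<forall>t u. to_nat (r t) = to_nat (r u) \<longleftrightarrow> Equal t u \<in> H" by simp
  then show ?thesis by (rule exI[of _ "\<lambda>t. to_nat (r t)"])
qed

text \<open>For a theory without finite models, an unprovable \<open>A\<close> fails in a term model
  with a countably infinite carrier, which can be renumbered to fill \<open>nat\<close>. Full
  carriers allow the arithmetic to be done on a type, with no relativised quantifiers.\<close>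

theorem completeness:
  assumes fin: "finite (\<Union>(fv_fm ` T))"
    and inf: "\<And>(M :: nat model) e. (\<And>B. B \<in> T \<Longrightarrow> sat M e B) \<Longrightarrow> range e \<subseteq> carrier M \<Longrightarrow>
      zero_m M \<in> carrier M \<Longrightarrow> one_m M \<in> carrier M \<Longrightarrow>
      (\<And>x y. add_m M x y \<in> carrier M) \<Longrightarrow> infinite (carrier M)"
    and val: "\<And>(M :: nat model) e. (\<And>B. B \<in> T \<Longrightarrow> sat M e B) \<Longrightarrow> carrier M = UNIV \<Longrightarrow> sat M e A"
  shows "T \<turnstile> A"
proof (rule Contradiction, rule ccontr)
  assume "\<not> insert (Neg A) T \<turnstile> Falsum"
  then obtain H where H: "henkin H" and TH: "T \<subseteq> H" and "Neg A \<in> H"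
    using henkin_extension[OF _ finite_fv_fm_insert[OF fin]] by blast
  then have A: "A \<notin> H" using henkin_Imp[OF H] henkin_Falsum[OF H] by blast
  obtain c :: "tm \<Rightarrow> nat" where c: "\<And>t u. c t = c u \<longleftrightarrow> Equal t u \<in> H"
    using term_naming_exists[OF H] by blast
  have "infinite (carrier (term_model H c))"
  proof (rule inf)
    show "sat (term_model H c) (\<lambda>i. c (Var i)) B" if "B \<in> T" for B
      using term_model_sat_iff[OF H c, of Var B] that TH by auto
  qed (auto simp: term_model_def)
  then have inf: "infinite (range c)" by (simp add: term_model_def)
  \<comment> \<open>Renaming along the increasing enumeration of the range makes the naming map
    surjective onto \<open>nat\<close> and identifies the same terms.\<close>
  define c' where "c' = (\<lambda>t. the_inv_into UNIV (enumerate (range c)) (c t))"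
  have inj: "inj (enumerate (range c))"
    using bij_enumerate[OF inf] by (rule bij_betw_imp_inj_on)
  have enum: "enumerate (range c) (c' t) = c t" for t
    unfolding c'_def using bij_enumerate[OF inf]
    by (intro f_the_inv_into_f[OF inj]) (auto simp: bij_betw_def)
  have c': "c' t = c' u \<longleftrightarrow> Equal t u \<in> H" for t u
    using enum[of t] enum[of u] c[of t u] by (auto simp: c'_def)
  have "n \<in> range c'" for n
  proof -
    obtain t where "enumerate (range c) n = c t" using enumerate_in_set[OF inf, of n] by blast
    then have "n = c' t" using enum[of t] by (metis injD[OF inj])
    then show ?thesis by blast
  qed
  then have "carrier (term_model H c') = UNIV" by (auto simp: term_model_def)
  moreover have "sat (term_model H c') (\<lambda>i. c' (Var i)) B" if "B \<in> T" for B
    using term_model_sat_iff[OF H c', of Var B] that TH by auto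
  ultimately have "sat (term_model H c') (\<lambda>i. c' (Var i)) A" by (intro val)
  then show False using term_model_sat_iff[OF H c', of Var A] A by simp
qed

section \<open>Arithmetic in models\<close>

lemma prime_less_17:
  fixes k :: nat
  assumes "Factorial_Ring.prime k" and "k < 17"
  shows "k \<in> {2, 3, 5, 7, 11, 13}"
proof -
  have "k \<in> {..<17}" using assms(2) by simp
  then show ?thesis using assms(1) by (auto simp: lessThan_nat_numeral)
qed

text \<open>There are no assumptions, so that the defined notions can be interpreted in a structure
  before its axioms have been verified.\<close>

locale arithmetic =
  fixes zero :: 'a  ("\<zero>")
    and one :: 'a  ("\<one>")
    and add :: "'a \<Rightarrow> 'a \<Rightarrow> 'a"  (infixl "\<oplus>" 65)
    and mul :: "'a \<Rightarrow> 'a \<Rightarrow> 'a"  (infixl "\<otimes>" 70)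
    and less :: "'a \<Rightarrow> 'a \<Rightarrow> bool"  (infix "\<prec>" 50)
begin

definition less_eq :: "'a \<Rightarrow> 'a \<Rightarrow> bool"  (infix "\<preceq>" 50) where
  "x \<preceq> y \<longleftrightarrow> x \<prec> y \<or> x = y"

definition is_divisor :: "'a \<Rightarrow> 'a \<Rightarrow> bool" where
  "is_divisor x y \<longleftrightarrow> (\<exists>z. x \<otimes> z = y)"

definition is_coprime :: "'a \<Rightarrow> 'a \<Rightarrow> bool" where
  "is_coprime x y \<longleftrightarrow> (\<forall>d. is_divisor d x \<and> is_divisor d y \<longrightarrow> d = \<one>)"

definition is_prime :: "'a \<Rightarrow> bool" where
  "is_prime x \<longleftrightarrow> \<one> \<prec> x \<and>
    (\<forall>a b c. x \<otimes> c = a \<otimes> b \<longrightarrow> is_divisor x a \<or> is_divisor x b)"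

definition are_consecutive :: "'a \<Rightarrow> 'a \<Rightarrow> bool" where
  "are_consecutive a b \<longleftrightarrow> is_prime a \<and> is_prime b \<and> a \<prec> b \<and>
    (\<forall>u. is_prime u \<and> a \<prec> u \<longrightarrow> b \<preceq> u)"

text \<open>This is the premise of \<open>p\<close>-goodness, split off because a witness that is
  not prime is what clause (ii) asks for.\<close>

definition is_witness :: "'a \<Rightarrow> 'a \<Rightarrow> 'a \<Rightarrow> bool" where
  "is_witness p n t \<longleftrightarrow> \<one> \<prec> t \<and> t \<prec> n \<and> is_coprime t n \<and>
    (\<forall>v. is_prime v \<and> v \<preceq> p \<longrightarrow> is_coprime v t)"

definition is_good :: "'a \<Rightarrow> 'a \<Rightarrow> bool" where
  "is_good p n \<longleftrightarrow> (\<forall>t. is_witness p n t \<longrightarrow> is_prime t)"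

primrec cast :: "nat \<Rightarrow> 'a" where
  "cast 0 = \<zero>"
| "cast (Suc n) = cast n \<oplus> \<one>"

end

locale pa_minus = arithmetic +
  assumes add_assoc: "(x \<oplus> y) \<oplus> z = x \<oplus> (y \<oplus> z)"
    and add_commute: "x \<oplus> y = y \<oplus> x"
    and mul_assoc: "(x \<otimes> y) \<otimes> z = x \<otimes> (y \<otimes> z)"
    and mul_commute: "x \<otimes> y = y \<otimes> x"
    and distrib_left: "x \<otimes> (y \<oplus> z) = x \<otimes> y \<oplus> x \<otimes> z"
    and add_zero [simp]: "x \<oplus> \<zero> = x"
    and mul_zero [simp]: "x \<otimes> \<zero> = \<zero>"
    and mul_one [simp]: "x \<otimes> \<one> = x"
    and less_trans': "x \<prec> y \<Longrightarrow> y \<prec> z \<Longrightarrow> x \<prec> z"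
    and less_irrefl': "\<not> x \<prec> x"
    and less_linear': "x \<prec> y \<or> x = y \<or> y \<prec> x"
    and add_less_mono: "x \<prec> y \<Longrightarrow> x \<oplus> z \<prec> y \<oplus> z"
    and mul_less_mono: "\<zero> \<prec> z \<Longrightarrow> x \<prec> y \<Longrightarrow> x \<otimes> z \<prec> y \<otimes> z"
    and less_imp_add: "x \<prec> y \<Longrightarrow> \<exists>z. x \<oplus> z = y"
    and zero_less_one [simp]: "\<zero> \<prec> \<one>"
    and pos_imp_ge_one: "\<zero> \<prec> x \<Longrightarrow> \<one> \<preceq> x"
    and pos_or_zero: "\<zero> \<prec> x \<or> x = \<zero>"

section \<open>Order and cancellation laws\<close>

sublocale pa_minus \<subseteq> linorder less_eq less
proof
  show "x \<prec> y \<longleftrightarrow> x \<preceq> y \<and> \<not> y \<preceq> x" for x y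
    unfolding less_eq_def using less_trans' less_irrefl' by blast
  show "x \<preceq> z" if "x \<preceq> y" "y \<preceq> z" for x y z
    using that unfolding less_eq_def using less_trans' by blast
  show "x = y" if "x \<preceq> y" "y \<preceq> x" for x y
    using that unfolding less_eq_def using less_trans' less_irrefl' by blast
  show "x \<preceq> y \<or> y \<preceq> x" for x y
    unfolding less_eq_def using less_linear' by blast
qed (simp add: less_eq_def)

context pa_minus
begin

lemma zero_add [simp]: "\<zero> \<oplus> x = x"
  by (simp add: add_commute[of \<zero>])

lemma zero_mul [simp]: "\<zero> \<otimes> x = \<zero>"
  by (simp add: mul_commute[of \<zero>])

lemma one_mul [simp]: "\<one> \<otimes> x = x"
  by (simp add: mul_commute[of \<one>])

lemma zero_le [simp]: "\<zero> \<preceq> x"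
  using pos_or_zero[of x] by (auto simp: less_eq_def)

lemma not_less_zero [simp]: "\<not> x \<prec> \<zero>"
  by (simp add: not_less)

lemma one_neq_zero [simp]: "\<one> \<noteq> \<zero>"
  using zero_less_one less_irrefl' by metis

lemma less_eq_antisym: "x \<preceq> y \<Longrightarrow> y \<preceq> x \<Longrightarrow> x = y"
  unfolding less_eq_def using less_trans' less_irrefl' by blast

lemma one_le_iff: "\<one> \<preceq> x \<longleftrightarrow> x \<noteq> \<zero>"
  using pos_or_zero[of x] pos_imp_ge_one[of x] zero_less_one by (auto simp: not_le[symmetric])

lemma mul_le_mono: "x \<preceq> y \<Longrightarrow> x \<otimes> z \<preceq> y \<otimes> z"
  using pos_or_zero[of z] mul_less_mono[of z x y] by (auto simp: less_eq_def)

lemma mul_le_mono': "x \<preceq> y \<Longrightarrow> z \<otimes> x \<preceq> z \<otimes> y"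
  using mul_le_mono by (simp add: mul_commute)

lemma mul_mono: "x \<preceq> y \<Longrightarrow> z \<preceq> w \<Longrightarrow> x \<otimes> z \<preceq> y \<otimes> w"
  by (meson mul_le_mono mul_le_mono' order_trans)

lemma square_less:
  assumes "x \<prec> y"
  shows "x \<otimes> x \<prec> y \<otimes> y"
proof -
  have "x \<otimes> x \<preceq> y \<otimes> x" using assms by (intro mul_le_mono) simp
  also have "y \<otimes> x \<prec> y \<otimes> y"
    using mul_less_mono[of y x y] assms le_less_trans[OF zero_le assms] by (simp add: mul_commute)
  finally show ?thesis .
qed

lemma mul_cancel:
  assumes "x \<otimes> z = y \<otimes> z" and "z \<noteq> \<zero>"
  shows "x = y"
  using less_linear'[of x y] mul_less_mono[of z x y] mul_less_mono[of z y x]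
    pos_or_zero[of z] assms less_irrefl' by auto

lemma mul_less_cancel: "x \<otimes> z \<prec> y \<otimes> z \<Longrightarrow> x \<prec> y"
  using mul_le_mono[of y x z] by (meson not_le)

lemma le_mul: "z \<noteq> \<zero> \<Longrightarrow> x \<preceq> x \<otimes> z"
  using mul_le_mono'[of \<one> z x] by (simp add: one_le_iff)

lemma less_add_one [simp]: "x \<prec> x \<oplus> \<one>"
  using add_less_mono[OF zero_less_one, of x] by (simp add: add_commute[of \<one>])

text \<open>Discreteness of the order: the difference supplied by A13 is nonzero, hence at least 1
  by A14.\<close>

lemma add_one_le_iff: "x \<oplus> \<one> \<preceq> y \<longleftrightarrow> x \<prec> y"
proof
  show "x \<prec> y" if "x \<oplus> \<one> \<preceq> y" using less_le_trans[OF less_add_one that] .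
next
  assume "x \<prec> y"
  then obtain z where z: "x \<oplus> z = y" using less_imp_add by blast
  then have "z \<noteq> \<zero>" using \<open>x \<prec> y\<close> by auto
  then have "\<one> = z \<or> \<one> \<prec> z" using one_le_iff[of z] by (auto simp: less_eq_def)
  then show "x \<oplus> \<one> \<preceq> y"
    using add_less_mono[of \<one> z x] z by (auto simp: add_commute less_eq_def)
qed

lemma less_add_one_iff: "x \<prec> y \<oplus> \<one> \<longleftrightarrow> x \<preceq> y"
  using add_one_le_iff[of y x] by (meson not_le)

section \<open>Numerals\<close>

lemma cast_add: "cast (m + n) = cast m \<oplus> cast n"
  by (induction n) (simp_all add: add_assoc)

lemma cast_mul: "cast (m * n) = cast m \<otimes> cast n"
proof (induction n)
  case (Suc n)
  have "cast (m * Suc n) = cast (m * n) \<oplus> cast m"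
    by (simp add: cast_add add_commute)
  then show ?case using Suc by (simp add: distrib_left)
qed simp

lemma cast_less: "m < n \<Longrightarrow> cast m \<prec> cast n"
proof (induction n)
  case (Suc n)
  then have "cast m \<preceq> cast n" by (auto simp: less_Suc_eq)
  then show ?case by (simp add: less_add_one_iff)
qed simp

lemma cast_less_iff [simp]: "cast m \<prec> cast n \<longleftrightarrow> m < n"
  using cast_less[of m n] cast_less[of n m] less_trans' less_irrefl' by (metis linorder_neqE_nat)

lemma cast_eq_iff [simp]: "cast m = cast n \<longleftrightarrow> m = n"
  using cast_less[of m n] cast_less[of n m] less_irrefl' by (metis linorder_neqE_nat)

lemma cast_le_iff [simp]: "cast m \<preceq> cast n \<longleftrightarrow> m \<le> n"
  by (auto simp: less_eq_def le_less)

lemma cast_one: "cast 1 = \<one>"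
  by simp

lemma one_less_cast_iff: "\<one> \<prec> cast n \<longleftrightarrow> 1 < n"
  using cast_less_iff[of 1 n] unfolding cast_one .

lemma cast_eq_one_iff: "cast n = \<one> \<longleftrightarrow> n = 1"
  using cast_eq_iff[of n 1] unfolding cast_one .

text \<open>By discreteness the numerals form an initial segment, even of a nonstandard model.
  Questions below a numeral thus become questions about \<open>nat\<close>.\<close>

lemma le_castE:
  assumes "x \<preceq> cast n"
  obtains k where "x = cast k" and "k \<le> n"
  using assms
proof (induction n arbitrary: thesis)
  case 0
  then show ?case using less_eq_antisym[of x \<zero>] by fastforce
next
  case (Suc n)
  then consider "x = cast (Suc n)" | "x \<preceq> cast n"
    by (auto simp: less_eq_def[of x "cast n \<oplus> \<one>"] less_add_one_iff)
  then show ?case using Suc.IH Suc.prems(1) by cases (blast, metis le_Suc_eq)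
qed

text \<open>For nonzero \<open>m\<close> the quotient is bounded by \<open>cast n\<close>, hence is
  itself a numeral.\<close>

lemma is_divisor_cast_iff: "is_divisor (cast m) (cast n) \<longleftrightarrow> m dvd n"
proof
  show "is_divisor (cast m) (cast n)" if "m dvd n"
    using that unfolding is_divisor_def dvd_def by (metis cast_mul)
next
  assume "is_divisor (cast m) (cast n)"
  then obtain z where z: "cast m \<otimes> z = cast n" unfolding is_divisor_def by blast
  show "m dvd n"
  proof (cases "m = 0")
    case True
    then have "cast n = cast 0" using z by simp
    then have "n = 0" unfolding cast_eq_iff .
    then show ?thesis by simp
  next
    case False
    then have "cast m \<noteq> cast 0" unfolding cast_eq_iff by simp
    then have "z \<preceq> cast n" using le_mul[of "cast m" z] z by (simp add: mul_commute)
    then obtain k where "z = cast k" by (rule le_castE)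
    then have "m * k = n" using z by (simp flip: cast_mul)
    then show ?thesis by (rule dvdI[OF sym])
  qed
qed

section \<open>Divisibility and primes\<close>

lemma is_divisor_refl [simp]: "is_divisor x x"
  unfolding is_divisor_def using mul_one by blast

lemma is_divisor_trans: "is_divisor x y \<Longrightarrow> is_divisor y z \<Longrightarrow> is_divisor x z"
  unfolding is_divisor_def by (metis mul_assoc)

lemma is_divisor_mul [simp]: "is_divisor x (x \<otimes> y)"
  and is_divisor_mul' [simp]: "is_divisor y (x \<otimes> y)"
  unfolding is_divisor_def using mul_commute by blast+

lemma is_divisor_le: "is_divisor x y \<Longrightarrow> y \<noteq> \<zero> \<Longrightarrow> x \<preceq> y"
  unfolding is_divisor_def using le_mul by (metis mul_zero)

lemma is_prime_gt_one: "is_prime p \<Longrightarrow> \<one> \<prec> p"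
  by (simp add: is_prime_def)

lemma gt_one_neq: "\<one> \<prec> p \<Longrightarrow> p \<noteq> \<one> \<and> p \<noteq> \<zero>"
  by auto

lemmas is_prime_neq = gt_one_neq[OF is_prime_gt_one]

lemma is_prime_dvd_mul:
  "is_prime p \<Longrightarrow> is_divisor p (a \<otimes> b) \<Longrightarrow> is_divisor p a \<or> is_divisor p b"
  unfolding is_prime_def is_divisor_def[of p "a \<otimes> b"] by blast

text \<open>Euclid's property implies irreducibility: \<open>p\<close> divides one of the two
  factors, which is then equal to \<open>p\<close>, and cancellation makes the other one 1.\<close>

lemma is_prime_divisor:
  assumes p: "is_prime p" and "is_divisor d p"
  shows "d = \<one> \<or> d = p"
proof -
  obtain z where z: "d \<otimes> z = p" using assms(2) unfolding is_divisor_def by blast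
  then have "d \<noteq> \<zero>" "z \<noteq> \<zero>" using is_prime_neq[OF p] by auto
  have "d \<preceq> p" "z \<preceq> p"
    using z le_mul \<open>d \<noteq> \<zero>\<close> \<open>z \<noteq> \<zero>\<close> mul_commute by metis+
  have "is_divisor p d \<or> is_divisor p z" using is_prime_dvd_mul[OF p, of d z] z by simp
  then have "p \<preceq> d \<or> p \<preceq> z"
    using is_divisor_le[of p] \<open>d \<noteq> \<zero>\<close> \<open>z \<noteq> \<zero>\<close> by blast
  then show ?thesis
  proof
    assume "p \<preceq> d"
    with \<open>d \<preceq> p\<close> show ?thesis using less_eq_antisym by blast
  next
    assume "p \<preceq> z"
    with \<open>z \<preceq> p\<close> have "z = p" using less_eq_antisym by blast
    then have "d \<otimes> p = \<one> \<otimes> p" using z by simp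
    then show ?thesis using mul_cancel is_prime_neq[OF p] by blast
  qed
qed

lemma is_prime_dvd_prime: "is_prime p \<Longrightarrow> is_prime q \<Longrightarrow> is_divisor p q \<Longrightarrow> p = q"
  using is_prime_divisor is_prime_neq by blast

lemma is_coprime_prime: "is_prime p \<Longrightarrow> \<not> is_divisor p x \<Longrightarrow> is_coprime p x"
  unfolding is_coprime_def using is_prime_divisor by blast

lemma not_is_coprime:
  "is_prime v \<Longrightarrow> is_divisor v x \<Longrightarrow> is_divisor v y \<Longrightarrow> \<not> is_coprime x y"
  unfolding is_coprime_def using is_prime_neq by blast

lemma is_prime_square_dvd:
  "is_prime p \<Longrightarrow> is_prime q \<Longrightarrow> is_divisor q (p \<otimes> p) \<Longrightarrow> q = p"
  using is_prime_dvd_mul is_prime_dvd_prime by blast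

lemma not_is_prime_square:
  assumes p: "is_prime p"
  shows "\<not> is_prime (p \<otimes> p)"
proof
  assume "is_prime (p \<otimes> p)"
  then have "p = p \<otimes> p" using is_prime_dvd_prime[OF p, of "p \<otimes> p"] by simp
  then have "\<one> \<otimes> p = p \<otimes> p" by simp
  then show False using mul_cancel is_prime_neq[OF p] by blast
qed

end

section \<open>Primes and good elements\<close>

locale sigma = pa_minus +
  assumes next_prime: "is_prime p \<Longrightarrow>
      \<exists>q. is_prime q \<and> p \<prec> q \<and> (\<forall>u. is_prime u \<and> p \<prec> u \<longrightarrow> q \<preceq> u)"
    and previous_prime: "is_prime p \<Longrightarrow> cast 2 \<prec> p \<Longrightarrow>
      \<exists>q. is_prime q \<and> q \<prec> p \<and> (\<forall>u. is_prime u \<and> u \<prec> p \<longrightarrow> u \<preceq> q)"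
    and prime_below_root: "cast 4 \<prec> n \<Longrightarrow>
      \<exists>p. is_prime p \<and> p \<otimes> p \<prec> n \<and> (\<forall>q. is_prime q \<and> p \<prec> q \<longrightarrow> n \<preceq> q \<otimes> q)"
    and square_less_product: "are_consecutive r p \<Longrightarrow> are_consecutive p q \<Longrightarrow> cast 17 \<prec> q \<Longrightarrow>
      q \<otimes> q \<prec> cast 2 \<otimes> p \<otimes> r"
    and prime_divisor: "\<one> \<prec> n \<Longrightarrow> \<exists>p. is_prime p \<and> is_divisor p n"
    and quotient_of_square: "are_consecutive p q \<Longrightarrow>
      \<exists>k. k \<otimes> p \<prec> q \<otimes> q \<and> q \<otimes> q \<prec> (k \<oplus> \<one>) \<otimes> p"
begin

text \<open>Ordinary primality says nothing about nonstandard \<open>a\<close>, \<open>b\<close>,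
  \<open>c\<close>, so Euclid's property does not transfer directly. Instead A20 supplies a prime of
  the model dividing \<open>cast n\<close>; it is a numeral and must be \<open>cast n\<close>
  itself.\<close>

lemma is_prime_cast_iff: "is_prime (cast n) \<longleftrightarrow> Factorial_Ring.prime n"
proof
  assume n: "is_prime (cast n)"
  then have "1 < n" using is_prime_gt_one[OF n] by (simp only: one_less_cast_iff)
  moreover have "m = 1 \<or> m = n" if "m dvd n" for m
    using is_prime_divisor[OF n, of "cast m"] that by (simp add: is_divisor_cast_iff cast_eq_one_iff)
  ultimately show "Factorial_Ring.prime n" by (simp add: prime_nat_iff)
next
  assume n: "Factorial_Ring.prime n"
  then have "1 < n" by (rule prime_gt_1_nat)
  then have "\<one> \<prec> cast n" by (simp only: one_less_cast_iff)
  then obtain u where u: "is_prime u" "is_divisor u (cast n)" using prime_divisor by blast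
  have "cast n \<noteq> \<zero>" using \<open>\<one> \<prec> cast n\<close> by auto
  with u(2) have "u \<preceq> cast n" by (rule is_divisor_le)
  then obtain m where m: "u = cast m" by (rule le_castE)
  then have "m dvd n" using u(2) by (simp add: is_divisor_cast_iff)
  then have "m = 1 \<or> m = n" using n by (simp add: prime_nat_iff)
  moreover have "m \<noteq> 1" using is_prime_gt_one[OF u(1)] m by auto
  ultimately show "is_prime (cast n)" using u(1) m by simp
qed

text \<open>A20 is applied to \<open>t\<close> and then to the cofactor \<open>z\<close>, which is
  not 1 because \<open>t\<close> is not prime. The primes \<open>v\<close> and \<open>w\<close> may
  coincide.\<close>

lemma not_is_primeE:
  assumes "\<one> \<prec> t" and "\<not> is_prime t"
  obtains v w where "is_prime v" and "is_prime w" and "is_divisor v t" and "is_divisor w t"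
    and "v \<otimes> w \<preceq> t"
proof -
  obtain v where v: "is_prime v" "is_divisor v t" using prime_divisor[OF assms(1)] by blast
  then obtain z where z: "v \<otimes> z = t" unfolding is_divisor_def by blast
  have "z \<noteq> \<zero>" using z assms(1) by auto
  moreover have "z \<noteq> \<one>" using z v(1) assms(2) by auto
  ultimately have "\<one> \<prec> z" using one_le_iff[of z] by (auto simp: less_eq_def)
  then obtain w where w: "is_prime w" "is_divisor w z" using prime_divisor by blast
  have "is_divisor w t" using is_divisor_trans[OF w(2)] z by auto
  moreover have "v \<otimes> w \<preceq> t"
    using mul_le_mono'[OF is_divisor_le[OF w(2) \<open>z \<noteq> \<zero>\<close>], of v] z by simp
  ultimately show thesis using that v w(1) by blast
qed

text \<open>The coprimality conditions exclude every prime below \<open>l\<close> from dividing a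
  witness. A composite witness has two prime factors, so it would be at least the square of
  \<open>l\<close> and hence at least \<open>n\<close>.\<close>

lemma is_goodI:
  assumes small: "\<And>u. is_prime u \<Longrightarrow> u \<prec> l \<Longrightarrow> u \<preceq> p \<or> is_divisor u n"
    and "n \<preceq> l \<otimes> l"
  shows "is_good p n"
  unfolding is_good_def
proof (intro allI impI, rule ccontr)
  fix t
  assume t: "is_witness p n t" and "\<not> is_prime t"
  then obtain v w where vw: "is_prime v" "is_prime w" "is_divisor v t" "is_divisor w t"
    "v \<otimes> w \<preceq> t"
    using not_is_primeE[of t] unfolding is_witness_def by blast
  have large: "l \<preceq> u" if u: "is_prime u" "is_divisor u t" for u
  proof (rule ccontr)
    assume "\<not> l \<preceq> u"
    then have "u \<preceq> p \<or> is_divisor u n" using small[OF u(1)] by (simp add: not_le)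
    then show False
      using t u not_is_coprime[OF u(1) is_divisor_refl u(2)] not_is_coprime[OF u(1) u(2), of n]
      unfolding is_witness_def by blast
  qed
  have "l \<otimes> l \<preceq> v \<otimes> w" using vw by (intro mul_mono large)
  then have "n \<preceq> t" using assms(2) vw(5) order_trans by blast
  then show False using t unfolding is_witness_def by (simp add: not_le[symmetric])
qed

text \<open>The only prime divisor of the square is \<open>s\<close>, which exceeds
  \<open>p\<close>. By A20 a common divisor with \<open>m\<close> other than 1 would make
  \<open>s\<close> divide \<open>m\<close>.\<close>

lemma square_witness:
  assumes s: "is_prime s" "p \<prec> s" "s \<otimes> s \<prec> m" and m: "\<not> is_divisor s m"
  shows "is_witness p m (s \<otimes> s)"
  unfolding is_witness_def
proof (intro conjI allI impI)
  have "\<one> \<otimes> \<one> \<prec> s \<otimes> s" by (rule square_less[OF is_prime_gt_one[OF s(1)]])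
  then show "\<one> \<prec> s \<otimes> s" by simp
  show "is_coprime (s \<otimes> s) m"
    unfolding is_coprime_def
  proof (intro allI impI, rule ccontr)
    fix d
    assume d: "is_divisor d (s \<otimes> s) \<and> is_divisor d m" and "d \<noteq> \<one>"
    have "s \<otimes> s \<noteq> \<zero>" using gt_one_neq[OF \<open>\<one> \<prec> s \<otimes> s\<close>] by simp
    then have "d \<noteq> \<zero>" using d unfolding is_divisor_def by auto
    then have "\<one> \<prec> d" using \<open>d \<noteq> \<one>\<close> one_le_iff[of d] by (auto simp: less_eq_def)
    then obtain u where u: "is_prime u" "is_divisor u d" using prime_divisor by blast
    then have "u = s" using is_prime_square_dvd[OF s(1)] is_divisor_trans d by blast
    then show False using m u(2) is_divisor_trans d by blast
  qed
  show "is_coprime v (s \<otimes> s)" if "is_prime v \<and> v \<preceq> p" for v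
    using that is_prime_square_dvd[OF s(1), of v] s(2) by (auto intro: is_coprime_prime)
qed (rule s(3))

lemma not_is_good_square:
  "is_prime s \<Longrightarrow> p \<prec> s \<Longrightarrow> s \<otimes> s \<prec> m \<Longrightarrow> \<not> is_divisor s m \<Longrightarrow> \<not> is_good p m"
  unfolding is_good_def using square_witness not_is_prime_square by blast

text \<open>A good \<open>m\<close> would be divisible by both primes, hence by their product. The
  upper bound allows only the product itself, which lies below the square of
  \<open>s\<close>.\<close>

lemma not_is_good_product:
  assumes r: "is_prime r" "p \<prec> r" and s: "is_prime s" "r \<prec> s"
    and m: "s \<otimes> s \<prec> m" "m \<prec> cast 2 \<otimes> s \<otimes> r"
  shows "\<not> is_good p m"
proof
  assume good: "is_good p m"
  have "r \<otimes> r \<prec> m" using square_less[OF s(2)] m(1) by (rule less_trans')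
  then have "is_divisor r m" using good r not_is_good_square by blast
  then obtain j where j: "r \<otimes> j = m" unfolding is_divisor_def by blast
  have "is_divisor s m" using good s r(2) m(1) not_is_good_square less_trans' by blast
  moreover have "\<not> is_divisor s r" using is_prime_dvd_prime[OF s(1) r(1)] s(2) by auto
  ultimately have "is_divisor s j" using is_prime_dvd_mul[OF s(1), of r j] j by blast
  then obtain i where i: "s \<otimes> i = j" unfolding is_divisor_def by blast
  have m_eq: "m = i \<otimes> (s \<otimes> r)"
    using i j by (metis mul_assoc mul_commute)
  then have "i \<otimes> (s \<otimes> r) \<prec> cast 2 \<otimes> (s \<otimes> r)" using m(2) by (simp add: mul_assoc)
  \<comment> \<open>Writing 2 as \<open>Suc 1\<close> exposes the summand 1, so that discreteness
    yields that \<open>i\<close> is at most 1.\<close>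
  then have "i \<prec> cast (Suc 1)"
    using mul_less_cancel by (metis Suc_1)
  then have "i \<preceq> \<one>" by (simp add: less_add_one_iff)
  then have "m \<preceq> s \<otimes> r" using mul_le_mono[of i \<one> "s \<otimes> r"] m_eq by simp
  also have "s \<otimes> r \<preceq> s \<otimes> s" using s(2) by (intro mul_le_mono') simp
  finally show False using m(1) by (simp add: not_le[symmetric])
qed

lemma next_prime_consecutive: "is_prime p \<Longrightarrow> \<exists>q. are_consecutive p q"
  unfolding are_consecutive_def using next_prime by blast

text \<open>The largest prime \<open>P\<close> with square below \<open>m\<close> is at least
  \<open>s'\<close>, so its successor exceeds 17 and A19 applies. The prime \<open>s\<close> lies
  below \<open>P\<close>, which keeps the predecessor \<open>r\<close> of \<open>P\<close> above
  \<open>p\<close>.\<close>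

lemma not_is_good_large:
  assumes s: "is_prime s" "p \<prec> s" and s': "is_prime s'" "s \<prec> s'" "cast 17 \<preceq> s'"
    and m: "s' \<otimes> s' \<prec> m"
  shows "\<not> is_good p m"
proof -
  have four: "cast 4 \<prec> s'" using less_le_trans[of "cast 4" "cast 17" s'] s'(3) by simp
  also have "s' \<preceq> s' \<otimes> s'" using is_prime_neq[OF s'(1)] by (intro le_mul) simp
  also note m
  finally have "cast 4 \<prec> m" .
  then obtain P where P: "is_prime P" "P \<otimes> P \<prec> m"
    "\<And>q. is_prime q \<Longrightarrow> P \<prec> q \<Longrightarrow> m \<preceq> q \<otimes> q"
    using prime_below_root by blast
  \<comment> \<open>Otherwise the choice of \<open>P\<close> would put \<open>m\<close> at or below
    the square of \<open>s'\<close>.\<close>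
  have "s' \<preceq> P" using P(3)[OF s'(1)] m by (meson not_le)
  then have "cast 17 \<preceq> P" "s \<prec> P"
    using s' order_trans less_le_trans by blast+
  then have "cast 2 \<prec> P" using less_le_trans[of "cast 2" "cast 17" P] by simp
  then obtain r where r: "is_prime r" "r \<prec> P" "\<And>u. is_prime u \<Longrightarrow> u \<prec> P \<Longrightarrow> u \<preceq> r"
    using previous_prime[OF P(1)] by blast
  have "p \<prec> r" using less_le_trans[OF s(2) r(3)[OF s(1) \<open>s \<prec> P\<close>]] .
  have "P \<preceq> u" if "is_prime u" "r \<prec> u" for u
    using r(3)[OF that(1)] that(2) by (meson not_le)
  then have "are_consecutive r P" using r P(1) unfolding are_consecutive_def by blast
  moreover obtain Q where Q: "are_consecutive P Q" using next_prime_consecutive[OF P(1)] by blast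
  then have "is_prime Q" "P \<prec> Q" unfolding are_consecutive_def by blast+
  moreover have "cast 17 \<prec> Q" using le_less_trans[OF \<open>cast 17 \<preceq> P\<close> \<open>P \<prec> Q\<close>] .
  ultimately have "Q \<otimes> Q \<prec> cast 2 \<otimes> P \<otimes> r" using square_less_product Q by blast
  then have "m \<prec> cast 2 \<otimes> P \<otimes> r"
    using P(3)[OF \<open>is_prime Q\<close> \<open>P \<prec> Q\<close>] by (rule le_less_trans[rotated])
  with r P \<open>p \<prec> r\<close> show ?thesis by (intro not_is_good_product[of r p P m])
qed

text \<open>The bound 11 makes the second prime after \<open>p\<close> at least 17. Elements beyond
  its square are covered by \<open>not_is_good_large\<close>; those between the largest multiple of
  \<open>q\<close> and that square fail because of the square of \<open>q\<close>.\<close>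

lemma maximal_good_large:
  assumes p: "is_prime p" and "cast 11 \<preceq> p"
  shows "\<exists>n. is_good p n \<and> (\<forall>m. n \<prec> m \<longrightarrow> \<not> is_good p m)"
proof -
  obtain q where q: "are_consecutive p q" using next_prime_consecutive[OF p] by blast
  then have "is_prime q" "p \<prec> q" and q_min: "\<And>u. is_prime u \<Longrightarrow> p \<prec> u \<Longrightarrow> q \<preceq> u"
    unfolding are_consecutive_def by blast+
  obtain r where r: "are_consecutive q r" using next_prime_consecutive[OF \<open>is_prime q\<close>] by blast
  then have "is_prime r" "q \<prec> r" and r_min: "\<And>u. is_prime u \<Longrightarrow> q \<prec> u \<Longrightarrow> r \<preceq> u"
    unfolding are_consecutive_def by blast+
  \<comment> \<open>Only the numeral 12 lies strictly between 11 and 13, and it is composite. The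
    bound on \<open>r\<close> excludes 14, 15 and 16 in the same way.\<close>
  have "cast 13 \<preceq> q"
  proof (rule ccontr)
    assume "\<not> cast 13 \<preceq> q"
    then have "q \<preceq> cast 13" by simp
    then obtain k where k: "q = cast k" "k \<le> 13" by (rule le_castE)
    have "11 < k" "k < 13"
      using le_less_trans[OF \<open>cast 11 \<preceq> p\<close> \<open>p \<prec> q\<close>] \<open>\<not> cast 13 \<preceq> q\<close> k by simp_all
    then have "k = 12" by simp
    moreover have "Factorial_Ring.prime k" using \<open>is_prime q\<close> k is_prime_cast_iff by simp
    ultimately show False by simp
  qed
  have "cast 17 \<preceq> r"
  proof (rule ccontr)
    assume "\<not> cast 17 \<preceq> r"
    then have "r \<preceq> cast 17" by simp
    then obtain k where k: "r = cast k" "k \<le> 17" by (rule le_castE)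
    have "13 < k" "k < 17"
      using le_less_trans[OF \<open>cast 13 \<preceq> q\<close> \<open>q \<prec> r\<close>] \<open>\<not> cast 17 \<preceq> r\<close> k by simp_all
    then have "k \<in> {14, 15, 16}" by auto
    moreover have "Factorial_Ring.prime k" using \<open>is_prime r\<close> k is_prime_cast_iff by simp
    ultimately show False by auto
  qed
  obtain k where k: "k \<otimes> q \<prec> r \<otimes> r" "r \<otimes> r \<prec> (k \<oplus> \<one>) \<otimes> q"
    using quotient_of_square[OF r] by blast
  have "is_good p (k \<otimes> q)"
  proof (rule is_goodI)
    show "u \<preceq> p \<or> is_divisor u (k \<otimes> q)" if "is_prime u" "u \<prec> r" for u
    proof (cases "u \<preceq> p")
      case False
      then have "q \<preceq> u" "u \<preceq> q" using q_min r_min that by (meson not_le)+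
      then have "u = q" using less_eq_antisym by blast
      then show ?thesis by simp
    qed simp
  qed (use k in simp)
  moreover have "\<not> is_good p m" if m: "k \<otimes> q \<prec> m" for m
  proof (cases "r \<otimes> r \<prec> m")
    case True
    then show ?thesis
      using \<open>is_prime q\<close> \<open>p \<prec> q\<close> \<open>is_prime r\<close> \<open>q \<prec> r\<close> \<open>cast 17 \<preceq> r\<close>
      by (intro not_is_good_large)
  next
    case False
    \<comment> \<open>Cancelling \<open>q\<close> shows that \<open>q\<close> is at most
      \<open>k\<close>, so the square of \<open>q\<close> is at most \<open>k\<close> times
      \<open>q\<close> and lies below \<open>m\<close>.\<close>
    have "q \<otimes> q \<prec> (k \<oplus> \<one>) \<otimes> q" using square_less[OF \<open>q \<prec> r\<close>] k(2) by (rule less_trans')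
    then have "q \<preceq> k" using mul_less_cancel less_add_one_iff by blast
    then have "q \<otimes> q \<prec> m" using le_less_trans[OF mul_le_mono m] by blast
    moreover have "\<not> is_divisor q m"
    proof
      assume "is_divisor q m"
      then obtain j where j: "m = j \<otimes> q" unfolding is_divisor_def using mul_commute by metis
      \<comment> \<open>The next multiple of \<open>q\<close> is already past the square of
        \<open>r\<close>.\<close>
      then have "k \<oplus> \<one> \<preceq> j" using m mul_less_cancel add_one_le_iff by blast
      then have "(k \<oplus> \<one>) \<otimes> q \<preceq> m" unfolding j by (rule mul_le_mono)
      with k(2) have "r \<otimes> r \<prec> m" by (rule less_le_trans)
      with False show False ..
    qed
    ultimately show ?thesis using \<open>is_prime q\<close> \<open>p \<prec> q\<close> not_is_good_square by blast
  qed
  ultimately show ?thesis by blast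
qed

text \<open>Since 13 and 17 are primes above \<open>p\<close>, nothing beyond 289, the square of 17,
  is good. Everything up to 289 is a numeral, so \<open>bad\<close> is a finite check on natural
  numbers.\<close>

lemma maximal_good_cast:
  fixes p n l :: nat
  assumes "p < 13" and small: "\<And>u. Factorial_Ring.prime u \<Longrightarrow> u < l \<Longrightarrow> u \<le> p \<or> u dvd n" and "n \<le> l * l"
    and bad: "\<And>m. n < m \<Longrightarrow> m \<le> 289 \<Longrightarrow>
      (\<And>s. Factorial_Ring.prime s \<Longrightarrow> p < s \<Longrightarrow> s * s < m \<Longrightarrow> s dvd m) \<Longrightarrow> False"
  shows "\<exists>n. is_good (cast p) n \<and> (\<forall>m. n \<prec> m \<longrightarrow> \<not> is_good (cast p) m)"
proof -
  have "is_good (cast p) (cast n)"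
  proof (rule is_goodI)
    show "u \<preceq> cast p \<or> is_divisor u (cast n)" if u: "is_prime u" "u \<prec> cast l" for u
    proof -
      have "u \<preceq> cast l" using u(2) by simp
      then obtain k where k: "u = cast k" by (rule le_castE)
      then show ?thesis
        using u small[of k] by (auto simp: is_prime_cast_iff is_divisor_cast_iff)
    qed
    show "cast n \<preceq> cast l \<otimes> cast l" using \<open>n \<le> l * l\<close> by (simp flip: cast_mul)
  qed
  moreover have "\<not> is_good (cast p) m" if m: "cast n \<prec> m" for m
  proof (cases "cast 17 \<otimes> cast 17 \<prec> m")
    case True
    then show ?thesis
      using \<open>p < 13\<close> by (intro not_is_good_large[of "cast 13" _ "cast 17"])
        (simp_all add: is_prime_cast_iff del: cast.simps)
  next
    case False
    then have "m \<preceq> cast (17 * 17)" by (simp only: cast_mul not_less)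
    then obtain k where k: "m = cast k" "k \<le> 17 * 17" by (rule le_castE)
    then obtain s where "Factorial_Ring.prime s" "p < s" "s * s < k" "\<not> s dvd k"
      using bad[of k] m by fastforce
    then show ?thesis
      using k by (intro not_is_good_square[of "cast s"])
        (simp_all add: is_prime_cast_iff is_divisor_cast_iff flip: cast_mul)
  qed
  ultimately show ?thesis by blast
qed

text \<open>In each small case \<open>n\<close> is the largest multiple, below the square of
  \<open>l\<close>, of the product of the primes strictly between \<open>p\<close> and
  \<open>l\<close>. The pairs (\<open>l\<close>, product) are (11, 105), (11, 35), (13, 77) and (17,
  143).\<close>

lemma maximal_good:
  assumes p: "is_prime p"
  shows "\<exists>n. is_good p n \<and> (\<forall>m. n \<prec> m \<longrightarrow> \<not> is_good p m)"
proof (cases "cast 11 \<preceq> p")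
  case False
  then have "p \<preceq> cast 11" by simp
  then obtain k where k: "p = cast k" by (rule le_castE)
  have "k < 11" using False k by simp
  moreover have "Factorial_Ring.prime k" using p k is_prime_cast_iff by simp
  ultimately consider "k = 2" | "k = 3" | "k = 5" | "k = 7" using prime_less_17[of k] by fastforce
  then show ?thesis
  proof cases
    case 1
    show ?thesis unfolding k 1
    proof (rule maximal_good_cast)
      show "u \<le> 2 \<or> u dvd 105" if "Factorial_Ring.prime u" "u < 11" for u :: nat
        using prime_less_17[of u] that by auto
      show False if m: "105 < m" "m \<le> 289"
        and dvd: "\<And>s. Factorial_Ring.prime s \<Longrightarrow> 2 < s \<Longrightarrow> s * s < m \<Longrightarrow> s dvd m" for m :: nat
      proof -
        \<comment> \<open>The only multiple of 105 left is 210, which exceeds 121 but is not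
          divisible by 11.\<close>
        have "3 dvd m" "5 dvd m" "7 dvd m" using m by (auto intro!: dvd)
        then have "105 dvd m" by presburger
        then have "m = 210" using m unfolding dvd_def by auto
        moreover from this have "11 dvd m" by (intro dvd) simp_all
        ultimately show False by simp
      qed
    qed simp_all
  next
    case 2
    show ?thesis unfolding k 2
    proof (rule maximal_good_cast)
      show "u \<le> 3 \<or> u dvd 105" if "Factorial_Ring.prime u" "u < 11" for u :: nat
        using prime_less_17[of u] that by auto
      show False if m: "105 < m" "m \<le> 289"
        and dvd: "\<And>s. Factorial_Ring.prime s \<Longrightarrow> 3 < s \<Longrightarrow> s * s < m \<Longrightarrow> s dvd m" for m :: nat
      proof -
        \<comment> \<open>Every remaining multiple of 35 exceeds 121, and none is divisible by
          11.\<close>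
        have "5 dvd m" "7 dvd m" using m by (auto intro!: dvd)
        then have "35 dvd m" by presburger
        then have *: "m \<in> {140, 175, 210, 245, 280}" using m unfolding dvd_def by auto
        then have "11 dvd m" by (intro dvd) auto
        with * show False by auto
      qed
    qed simp_all
  next
    case 3
    show ?thesis unfolding k 3
    proof (rule maximal_good_cast)
      show "u \<le> 5 \<or> u dvd 154" if "Factorial_Ring.prime u" "u < 13" for u :: nat
        using prime_less_17[of u] that by auto
      show False if m: "154 < m" "m \<le> 289"
        and dvd: "\<And>s. Factorial_Ring.prime s \<Longrightarrow> 5 < s \<Longrightarrow> s * s < m \<Longrightarrow> s dvd m" for m :: nat
      proof -
        \<comment> \<open>The only multiple of 77 left is 231, which exceeds 169 but is not
          divisible by 13.\<close>
        have "7 dvd m" "11 dvd m" using m by (auto intro!: dvd)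
        then have "77 dvd m" by presburger
        then have "m = 231" using m unfolding dvd_def by auto
        moreover from this have "13 dvd m" by (intro dvd) simp_all
        ultimately show False by simp
      qed
    qed simp_all
  next
    case 4
    show ?thesis unfolding k 4
    proof (rule maximal_good_cast)
      show "u \<le> 7 \<or> u dvd 286" if "Factorial_Ring.prime u" "u < 17" for u :: nat
        using prime_less_17[of u] that by auto
      show False if m: "286 < m" "m \<le> 289"
        and dvd: "\<And>s. Factorial_Ring.prime s \<Longrightarrow> 7 < s \<Longrightarrow> s * s < m \<Longrightarrow> s dvd m" for m :: nat
      proof -
        \<comment> \<open>The multiples of 143 jump from 286 to 429.\<close>
        have "11 dvd m" "13 dvd m" using m by (auto intro!: dvd)
        then have "143 dvd m" by presburger
        with m show False unfolding dvd_def by auto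
      qed
    qed simp_all
  qed
qed (rule maximal_good_large[OF p])

end

section \<open>Models of the theory\<close>

lemmas connective_defs = all_d_def zero_d_def one_d_def add_d_def mul_d_def equal_d_def less_d_def
  imp_d_def neg_d_def disj_d_def conj_d_def ex_d_def

lemmas axiom_defs = A1_def A2_def A3_def A4_def A5_def A6_def A7_def A8_def A9_def A10_def
  A11_def A12_def A13_def A14_def A15_def A16_def A17_def A18_def A19_def A20_def A21_def

lemma finite_Sigma': "finite Sigma'"
  by (simp add: Sigma'_def)

text \<open>The numerals form a strictly increasing sequence. The axioms are used relativised to the
  carrier, because this result is what allows \<open>completeness\<close> to pass to full
  carriers.\<close>

lemma infinite_model:
  assumes sat: "\<And>A. A \<in> Sigma' \<Longrightarrow> sat M e A"
    and closed: "zero_m M \<in> carrier M" "one_m M \<in> carrier M"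
      "\<And>x y. add_m M x y \<in> carrier M"
  shows "infinite (carrier M)"
proof -
  have ax: "sat M e (A 0)" if "A \<in> {A2, A6, A8, A9, A11, A14}" for A
    using sat that unfolding Sigma'_def by blast
  note unf = axiom_defs connective_defs
  have comm: "add_m M x y = add_m M y x" if "x \<in> carrier M" "y \<in> carrier M" for x y
    using ax[of A2] that by (simp add: unf)
  have zero: "add_m M x (zero_m M) = x" if "x \<in> carrier M" for x
    using ax[of A6] that by (simp add: unf)
  have trans: "less_m M x z"
    if "x \<in> carrier M" "y \<in> carrier M" "z \<in> carrier M" "less_m M x y" "less_m M y z" for x y z
    using ax[of A8] that by (simp (no_asm_use) add: unf) meson
  have irrefl: "\<not> less_m M x x" if "x \<in> carrier M" for x
    using ax[of A9] that by (simp add: unf)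
  have mono: "less_m M (add_m M x z) (add_m M y z)"
    if "x \<in> carrier M" "y \<in> carrier M" "z \<in> carrier M" "less_m M x y" for x y z
    using ax[of A11] that by (simp add: unf)
  have pos: "less_m M (zero_m M) (one_m M)"
    using ax[of A14] closed(1) by (auto simp: unf leq_def)
  define f where "f = rec_nat (zero_m M) (\<lambda>_ x. add_m M x (one_m M))"
  have f: "f 0 = zero_m M" "f (Suc n) = add_m M (f n) (one_m M)" for n
    by (simp_all add: f_def)
  have mem: "f n \<in> carrier M" for n
    by (cases n) (simp_all add: f closed)
  \<comment> \<open>A11 adds \<open>f n\<close> on the right of 0 < 1; commutativity then gives the
    successor.\<close>
  have step: "less_m M (f n) (f (Suc n))" for n
    using mono[OF closed(1,2) mem[of n] pos] comm[OF closed(1) mem[of n]] comm[OF closed(2) mem[of n]]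
    by (simp add: f zero mem)
  have "less_m M (f m) (f n)" if "m < n" for m n
    using that
  proof (induction n)
    case (Suc n)
    then show ?case using step[of n] trans[OF mem mem mem] by (metis less_Suc_eq)
  qed simp
  then have "inj f" using irrefl mem by (metis injI linorder_neqE_nat)
  then have "infinite (range f)" by (simp add: finite_image_iff)
  moreover have "range f \<subseteq> carrier M" using mem by blast
  ultimately show ?thesis using finite_subset by blast
qed

text \<open>Under one more quantifier the index of a variable bound further out grows by one, and
  the extended environment returns its old value.\<close>

lemma case_nat_diff: "k < d \<Longrightarrow> case_nat a e (d - k) = e (d - Suc k)"
  by (simp split: nat.split) (metis Suc_diff_Suc diff_Suc_Suc nat.inject)

abbreviation var :: "nat \<Rightarrow> dtm" where
  "var k \<equiv> (\<lambda>d. Var (d - Suc k))"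

section \<open>Truth of the defined notions\<close>

text \<open>The variable \<open>var k\<close> is the one bound by the quantifier at depth \<open>k\<close>.\<close>

context
  fixes M :: "('a, 'b) model_scheme"
  assumes M: "carrier M = UNIV"
begin

interpretation arithmetic "zero_m M" "one_m M" "add_m M" "mul_m M" "less_m M" .

lemma sat_leq: "sat M e ((x \<^bold>\<le> y) d) \<longleftrightarrow> less_eq (tm_val M e (x d)) (tm_val M e (y d))"
  by (auto simp: leq_def connective_defs less_eq_def)

text \<open>The bounds say that both variables are bound by enclosing quantifiers, so that unfolding
  further quantifiers preserves their values.\<close>

lemma sat_divides: "k < d \<Longrightarrow> l < d \<Longrightarrow>
    sat M e ((var k \<^bold>\<bar> var l) d) \<longleftrightarrow> is_divisor (e (d - Suc k)) (e (d - Suc l))"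
  by (simp add: divides_def connective_defs is_divisor_def M case_nat_diff)

lemma sat_relprime: "k < d \<Longrightarrow> l < d \<Longrightarrow>
    sat M e (relprime (var k) (var l) d) \<longleftrightarrow> is_coprime (e (d - Suc k)) (e (d - Suc l))"
  by (simp add: relprime_def connective_defs sat_divides is_coprime_def M case_nat_diff)

lemma sat_prime: "k < d \<Longrightarrow> sat M e (Defs.prime (var k) d) \<longleftrightarrow> is_prime (e (d - Suc k))"
  by (auto simp: Defs.prime_def connective_defs sat_divides is_prime_def M case_nat_diff)

lemma sat_consecutive: "k < d \<Longrightarrow> l < d \<Longrightarrow>
    sat M e (consecutive (var k) (var l) d) \<longleftrightarrow> are_consecutive (e (d - Suc k)) (e (d - Suc l))"
  by (auto simp: consecutive_def connective_defs sat_prime sat_leq are_consecutive_def M case_nat_diff)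

lemma sat_good: "k < d \<Longrightarrow> l < d \<Longrightarrow>
    sat M e (good (var k) (var l) d) \<longleftrightarrow> is_good (e (d - Suc k)) (e (d - Suc l))"
  by (auto simp: good_def connective_defs sat_prime sat_leq sat_relprime is_good_def is_witness_def
      M case_nat_diff)

lemmas sat_notions = sat_leq sat_divides sat_relprime sat_prime sat_consecutive sat_good

end

section \<open>From satisfied axioms to the arithmetic locales\<close>

lemma pa_minus_model:
  assumes sat: "\<And>A. A \<in> Sigma' \<Longrightarrow> sat M e A" and M: "carrier M = UNIV"
  shows "pa_minus (zero_m M) (one_m M) (add_m M) (mul_m M) (less_m M)"
proof -
  interpret arithmetic "zero_m M" "one_m M" "add_m M" "mul_m M" "less_m M" .
  have ax: "sat M e (A 0)"
    if "A \<in> {A1, A2, A3, A4, A5, A6, A7, A8, A9, A10, A11, A12, A13, A14, A15}" for A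
    using sat that unfolding Sigma'_def by blast
  note unf = axiom_defs connective_defs M sat_leq[OF M]
  show ?thesis
  proof
    fix x y z
    show "add_m M (add_m M x y) z = add_m M x (add_m M y z)"
      using ax[of A1] by (simp add: unf)
    show "add_m M x y = add_m M y x"
      using ax[of A2] by (simp add: unf)
    show "mul_m M (mul_m M x y) z = mul_m M x (mul_m M y z)"
      using ax[of A3] by (simp add: unf)
    show "mul_m M x y = mul_m M y x"
      using ax[of A4] by (simp add: unf)
    show "mul_m M x (add_m M y z) = add_m M (mul_m M x y) (mul_m M x z)"
      using ax[of A5] by (simp add: unf)
    show "add_m M x (zero_m M) = x"
      using ax[of A6] by (simp add: unf)
    show "mul_m M x (zero_m M) = zero_m M"
      using ax[of A6] by (simp add: unf)
    show "mul_m M x (one_m M) = x"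
      using ax[of A7] by (simp add: unf)
    show "less_m M x z" if "less_m M x y" "less_m M y z"
      using ax[of A8] that by (simp (no_asm_use) add: unf) meson
    show "\<not> less_m M x x"
      using ax[of A9] by (simp add: unf)
    show "less_m M x y \<or> x = y \<or> less_m M y x"
      using ax[of A10] by (auto simp: unf)
    show "less_m M (add_m M x z) (add_m M y z)" if "less_m M x y"
      using ax[of A11] that by (simp add: unf)
    show "less_m M (mul_m M x z) (mul_m M y z)" if "less_m M (zero_m M) z" "less_m M x y"
      using ax[of A12] that by (simp add: unf)
    show "\<exists>z. add_m M x z = y" if "less_m M x y"
      using ax[of A13] that by (simp add: unf)
    show "less_m M (zero_m M) (one_m M)"
      using ax[of A14] by (simp add: unf)
    show "less_eq (one_m M) x" if "less_m M (zero_m M) x"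
      using ax[of A14] that by (simp add: unf)
    show "less_m M (zero_m M) x \<or> x = zero_m M"
      using ax[of A15] by (auto simp: unf)
  qed
qed

text \<open>The recursion of \<open>num\<close> restarts at 1, whereas \<open>cast\<close> adds ones
  to 0; the two agree because 0 + 1 = 1 in the model.\<close>

lemma tm_val_num:
  assumes "pa_minus (zero_m M) (one_m M) (add_m M) (mul_m M) (less_m M)"
  shows "tm_val M e (num n d) = arithmetic.cast (zero_m M) (one_m M) (add_m M) n"
proof -
  interpret pa_minus "zero_m M" "one_m M" "add_m M" "mul_m M" "less_m M" by fact
  show ?thesis by (induction n rule: num.induct) (simp_all add: zero_d_def one_d_def add_d_def)
qed

lemma sigma_model:
  assumes sat: "\<And>A. A \<in> Sigma' \<Longrightarrow> sat M e A" and M: "carrier M = UNIV"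
  shows "sigma (zero_m M) (one_m M) (add_m M) (mul_m M) (less_m M)"
proof -
  note pa = pa_minus_model[OF assms]
  interpret pa_minus "zero_m M" "one_m M" "add_m M" "mul_m M" "less_m M" by (rule pa)
  have ax: "sat M e (A 0)" if "A \<in> {A16, A17, A18, A19, A20, A21}" for A
    using sat that unfolding Sigma'_def by blast
  note unf = connective_defs M tm_val_num[OF pa] sat_notions[OF M]
  show ?thesis
  proof unfold_locales
    fix p assume "is_prime p"
    then show "\<exists>q. is_prime q \<and> less_m M p q \<and> (\<forall>u. is_prime u \<and> less_m M p u \<longrightarrow> less_eq q u)"
      using ax[of A16] unfolding A16_def
      by (simp add: unf del: num.simps) meson
  next
    fix p assume "is_prime p" "less_m M (cast 2) p"
    then show "\<exists>q. is_prime q \<and> less_m M q p \<and> (\<forall>u. is_prime u \<and> less_m M u p \<longrightarrow> less_eq u q)"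
      using ax[of A17] unfolding A17_def
      by (simp add: unf del: num.simps cast.simps) meson
  next
    fix n assume "less_m M (cast 4) n"
    then show "\<exists>p. is_prime p \<and> less_m M (mul_m M p p) n \<and>
        (\<forall>q. is_prime q \<and> less_m M p q \<longrightarrow> less_eq n (mul_m M q q))"
      using ax[of A18] unfolding A18_def
      by (simp add: unf del: num.simps cast.simps) meson
  next
    fix n assume "less_m M (one_m M) n"
    then show "\<exists>p. is_prime p \<and> is_divisor p n"
      using ax[of A20] unfolding A20_def
      by (simp add: unf)
  next
    fix p q assume "are_consecutive p q"
    then show "\<exists>k. less_m M (mul_m M k p) (mul_m M q q) \<and>
        less_m M (mul_m M q q) (mul_m M (add_m M k (one_m M)) p)"
      using ax[of A21] unfolding A21_def
      by (simp add: unf)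
  next
    fix r p q
    assume *: "are_consecutive r p" "are_consecutive p q" "less_m M (cast 17) q"
    then have "is_prime r" "is_prime p" "is_prime q" "less_m M r p" "less_m M p q"
      unfolding are_consecutive_def by blast+
    with * show "less_m M (mul_m M q q) (mul_m M (mul_m M (cast 2) p) r)"
      using ax[of A19] unfolding A19_def
      by (simp add: unf del: num.simps cast.simps)
  qed
qed

theorem theorem4p2: "Sigma' \<turnstile> GSs"
proof (rule completeness)
  show "finite (\<Union>(fv_fm ` Sigma'))" by (simp add: finite_Sigma' finite_fv_fm)
next
  fix M :: "nat model" and e
  assume "\<And>B. B \<in> Sigma' \<Longrightarrow> sat M e B" and M: "carrier M = UNIV"
  then interpret sigma "zero_m M" "one_m M" "add_m M" "mul_m M" "less_m M" by (rule sigma_model)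
  \<comment> \<open>Clause (ii) is the failure of goodness of \<open>m\<close>, expressed by a
    witness that is not prime.\<close>
  have "\<forall>p. is_prime p \<longrightarrow> (\<exists>n. is_good p n \<and>
      (\<forall>m. less_m M n m \<longrightarrow> (\<exists>q. is_witness p m q \<and> \<not> is_prime q)))"
    using maximal_good unfolding is_good_def[of _ m for m] by blast
  then show "sat M e GSs"
    unfolding GSs_def by (simp add: connective_defs M sat_notions[OF M] is_witness_def) meson
qed (rule infinite_model)

end
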